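(* $\mathrm{SSCM}(3,1;5;2,2)=\mathrm{RE}$. That is, a language is recursively enumerable if and only if it is generated by a simple semi-conditional matrix grammar of degree $(3,1)$ with at most $5$ nonterminals, at most $2$ conditional matrices, and all matrices of length at most $2$.
   Context: A semi-conditional matrix (SCM) grammar is a quadruple $G=(V,T,M,S)$ with the following components. - $V$ is a finite alphabet and $T\subsetneq V$ is the set of terminals. - $N=V\setminus T$ is the set of nonterminals and $S\in N$ is the start symbol. - $M$ is a finite set of matrices of the form $r=[(A_1\to x_1),\dots,(A_\ell\to x_\ell),P,F]$, where $\ell\ge 1$, $A_k\in N$, $x_k\in V^*$, and $P,F\in V^+\cup\{\emptyset\}$. Here $\emptyset\notin V$ is a special symbol meaning that the condition is absent, and $|\emptyset|=0$. The number $\ell$ is the length of $r$. A matrix is classified as follows: - unconditional if $P=F=\emptyset$, and conditional otherwise; - simple if at least one of $P,F$ equals $\emptyset$, and non-simple if both $P\neq\emptyset$ and $F\neq\emptyset$. For $x,y\in V^*$ we write $x\Rightarrow_r y$ iff all of the following hold: 1. if $P\neq\emptyset$ then $P$ is a subword (factor) of $x$; 2. if $F\neq\emptyset$ then $F$ is not a subword of $x$; 3. there are words $x=y_0,y_1,\dots,y_\ell=y$ such that $y_k$ is obtained from $y_{k-1}$ by replacing one occurrence of $A_k$ by $x_k$. $\Rightarrow_G$ is the union of the relations $\Rightarrow_r$ over $r\in M$, and $L(G)=\{y\in T^*: S\Rightarrow_G^* y\}$. $G$ has degree $(i,j)$ if every matrix satisfies $|P|\le i$ and $|F|\le j$. $\mathrm{SCM}(i,j;n;m,\ell,s)$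 denotes the family of languages $L(G)$ of SCM grammars $G$ that satisfy all of the following: - $G$ has degree $(i,j)$; - $|N|\le n$; - $G$ has at most $m$ conditional matrices; - every matrix of $G$ has length at most $\ell$; - $G$ has at most $s$ non-simple matrices. A $*$ in a parameter position means that parameter is unbounded. $\mathrm{SSCM}(i,j;n;m,\ell)=\mathrm{SCM}(i,j;n;m,\ell,0)$, i.e., all matrices are simple. $\mathrm{RE}$ is the class of recursively enumerable languages. *)

theory Defs
  imports Main "HOL-Library.Sublist"
begin

datatype 't sym = Tm 't | Nt nat

(* A matrix [(A1->x1),...,(Al->xl), P, F]; the conditions use None for the
   special symbol "absent" (emptyset). *)
type_synonym 't matrix = "(nat \<times> 't sym list) list \<times> 't sym list option \<times> 't sym list option"

record 't scm =
  sT :: "'t set"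
  sN :: "nat set"
  sS :: nat
  sM :: "'t matrix set"

definition scm_V :: "'t scm \<Rightarrow> 't sym set" where
  "scm_V G = Tm ` sT G \<union> Nt ` sN G"

definition olen :: "'a list option \<Rightarrow> nat" where
  "olen p = (case p of None \<Rightarrow> 0 | Some x \<Rightarrow> length x)"

definition scm_wf :: "'t scm \<Rightarrow> bool" where
  "scm_wf G \<longleftrightarrow> finite (sT G) \<and> finite (sN G) \<and> sS G \<in> sN G \<and> finite (sM G) \<and>
     (\<forall>(rs, P, F) \<in> sM G.
        rs \<noteq> [] \<and>
        (\<forall>(A, w) \<in> set rs. A \<in> sN G \<and> set w \<subseteq> scm_V G) \<and>
        (\<forall>p. P = Some p \<longrightarrow> p \<noteq> [] \<and> set p \<subseteq> scm_V G) \<and>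
        (\<forall>f. F = Some f \<longrightarrow> f \<noteq> [] \<and> set f \<subseteq> scm_V G))"

fun rewrite_seq :: "(nat \<times> 't sym list) list \<Rightarrow> 't sym list \<Rightarrow> 't sym list \<Rightarrow> bool" where
  "rewrite_seq [] x y = (x = y)"
| "rewrite_seq ((A, w) # rs) x y =
     (\<exists>u v. x = u @ [Nt A] @ v \<and> rewrite_seq rs (u @ w @ v) y)"

definition matrix_step :: "'t matrix \<Rightarrow> 't sym list \<Rightarrow> 't sym list \<Rightarrow> bool" where
  "matrix_step r x y \<longleftrightarrow> (case r of (rs, P, F) \<Rightarrow>
      (case P of None \<Rightarrow> True | Some p \<Rightarrow> sublist p x) \<and>
      (case F of None \<Rightarrow> True | Some f \<Rightarrow> \<not> sublist f x) \<and>
      rewrite_seq rs x y)"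

definition scm_step :: "'t scm \<Rightarrow> 't sym list \<Rightarrow> 't sym list \<Rightarrow> bool" where
  "scm_step G x y \<longleftrightarrow> (\<exists>r \<in> sM G. matrix_step r x y)"

definition scm_lang :: "'t scm \<Rightarrow> 't list set" where
  "scm_lang G = {w. set w \<subseteq> sT G \<and> (scm_step G)\<^sup>*\<^sup>* [Nt (sS G)] (map Tm w)}"

definition conditional :: "'t matrix \<Rightarrow> bool" where
  "conditional r \<longleftrightarrow> (case r of (rs, P, F) \<Rightarrow> P \<noteq> None \<or> F \<noteq> None)"

definition nonsimple :: "'t matrix \<Rightarrow> bool" where
  "nonsimple r \<longleftrightarrow> (case r of (rs, P, F) \<Rightarrow> P \<noteq> None \<and> F \<noteq> None)"

definition in_SCM :: "nat \<Rightarrow> nat \<Rightarrow> nat \<Rightarrow> nat \<Rightarrow> nat \<Rightarrow> nat \<Rightarrow> 't scm \<Rightarrow> bool" where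
  "in_SCM i j n m l s G \<longleftrightarrow> scm_wf G \<and>
     (\<forall>(rs, P, F) \<in> sM G. olen P \<le> i \<and> olen F \<le> j \<and> length rs \<le> l) \<and>
     card (sN G) \<le> n \<and>
     card {r \<in> sM G. conditional r} \<le> m \<and>
     card {r \<in> sM G. nonsimple r} \<le> s"

definition in_SSCM :: "nat \<Rightarrow> nat \<Rightarrow> nat \<Rightarrow> nat \<Rightarrow> nat \<Rightarrow> 't scm \<Rightarrow> bool" where
  "in_SSCM i j n m l G \<longleftrightarrow> in_SCM i j n m l 0 G"

(* Recursively enumerable languages: languages generated by (unrestricted,
   type-0) phrase-structure grammars. *)
record 't psg =
  gT :: "'t set"
  gN :: "nat set"
  gS :: nat
  gR :: "('t sym list \<times> 't sym list) set"

definition psg_V :: "'t psg \<Rightarrow> 't sym set" where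
  "psg_V G = Tm ` gT G \<union> Nt ` gN G"

definition psg_wf :: "'t psg \<Rightarrow> bool" where
  "psg_wf G \<longleftrightarrow> finite (gT G) \<and> finite (gN G) \<and> gS G \<in> gN G \<and> finite (gR G) \<and>
     (\<forall>(a, b) \<in> gR G. set a \<subseteq> psg_V G \<and> set b \<subseteq> psg_V G \<and>
        (\<exists>A \<in> gN G. Nt A \<in> set a))"

definition psg_step :: "'t psg \<Rightarrow> 't sym list \<Rightarrow> 't sym list \<Rightarrow> bool" where
  "psg_step G x y \<longleftrightarrow> (\<exists>(a, b) \<in> gR G. \<exists>u v. x = u @ a @ v \<and> y = u @ b @ v)"

definition psg_lang :: "'t psg \<Rightarrow> 't list set" where
  "psg_lang G = {w. set w \<subseteq> gT G \<and> (psg_step G)\<^sup>*\<^sup>* [Nt (gS G)] (map Tm w)}"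

definition is_RE :: "'t list set \<Rightarrow> bool" where
  "is_RE L \<longleftrightarrow> (\<exists>G. psg_wf G \<and> psg_lang G = L)"

end

theory Submission
  imports Defs
begin

text \<open>
  A simple grammar of degree (i, 1) is simulated by a phrase-structure grammar whose sentential forms
  carry a head that checks the condition of a matrix and then executes its rules one by one.

  Conversely, five nonterminals A, B, X, Y, S (numbered 0 to 4) suffice. A and B serve as bits, and a
  sentential form is U S V, where S is a head between two stacks. Equal bits meeting at the head are
  cancelled: [A -> X, A -> Y] or [B -> X, B -> Y] marks two equal bits, a matrix permitted by XSY
  erases X and S, and a matrix forbidding X turns Y into S. Any superfluous mark leaves an X that can
  never be removed.

  The right stack holds the code of a sentential form x of the phrase-structure grammar, followed by
  one extra B. A rule a -> b with name r is applied by pushing the mirrored code of a r on the left,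
  which cancels a and leaves r, and then pushing the code of r b on the right, which cancels r. Since
  pushes may be interleaved arbitrarily, correctness rests on the observation that inserting r b and
  erasing a r anywhere in a word only yields derivations of the original grammar. Codes have as
  many A as B, so the surplus B, which is erased together with S in the last step, shows that the
  start symbol was pushed exactly once.
\<close>

lemma sublist_singleton: "sublist [s] x \<longleftrightarrow> s \<in> set x"
  by (auto simp: sublist_def in_set_conv_decomp)

section \<open>Simple grammars generate recursively enumerable languages\<close>

text \<open>\<open>Init\<close> becomes the start symbol, and \<open>LeftEnd\<close> and
  \<open>RightEnd\<close> only delimit the word. \<open>Apply rs\<close> walks along the word with
  the rules \<open>rs\<close> of the chosen matrix still to be executed, so \<open>Apply []\<close>
  is the idle state. \<open>Check s rs\<close> scans for the forbidden symbol \<open>s\<close>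
  before \<open>rs\<close> may start, and \<open>Out\<close> checks that only terminals
  remain.\<close>

datatype 't head = Init | LeftEnd | RightEnd | Out | Apply "(nat \<times> 't sym list) list"
  | Check "'t sym" "(nat \<times> 't sym list) list"

text \<open>The type of heads is infinite, so only the finite set \<open>Q\<close> of those that can
  occur is numbered by \<open>q\<close>, away from the nonterminals of \<open>G\<close>. Suffixes
  enter because a matrix is executed from its front; \<open>hd f\<close> is the whole forbidding
  word, whose length is one.\<close>

locale simple_scm =
  fixes G :: "'t scm" and q :: "'t head \<Rightarrow> nat" and Q :: "'t head set"
  assumes wf: "scm_wf G"
    and simple: "(rs, P, F) \<in> sM G \<Longrightarrow> P = None \<or> F = None"
    and forbid_short: "(rs, P, F) \<in> sM G \<Longrightarrow> olen F \<le> 1"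
    and Q_def: "Q = {Init, LeftEnd, RightEnd, Out, Apply []}
      \<union> (\<Union>(rs, P, F) \<in> sM G. Apply ` set (suffixes rs) \<union> (case F of None \<Rightarrow> {} | Some f \<Rightarrow> {Check (hd f) rs}))"
    and q_inj: "inj_on q Q" and q_fresh: "q ` Q \<inter> sN G = {}"
begin

abbreviation h :: "'t head \<Rightarrow> 't sym" where "h s \<equiv> Nt (q s)"
abbreviation V :: "'t sym set" where "V \<equiv> scm_V G"

text \<open>The heads at which rules fire. Every form of the invariant below contains at most one of
  them, which makes the place of a rule application unique.\<close>

definition active :: "'t head set" where
  "active = Q - {LeftEnd, RightEnd}"

text \<open>A rule (a, s, b, c) rewrites a @ [h s] @ b to c.\<close>

inductive_set rules :: "('t sym list \<times> 't head \<times> 't sym list \<times> 't sym list) set" where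
  start: "([], Init, [], [h LeftEnd, h (Apply []), Nt (sS G), h RightEnd]) \<in> rules"
| right: "Apply rs \<in> Q \<Longrightarrow> s \<in> V \<Longrightarrow> ([], Apply rs, [s], [s, h (Apply rs)]) \<in> rules"
| left: "Apply rs \<in> Q \<Longrightarrow> s \<in> V \<Longrightarrow> ([s], Apply rs, [], [h (Apply rs), s]) \<in> rules"
| app: "Apply ((A, w) # rs) \<in> Q \<Longrightarrow> ([], Apply ((A, w) # rs), [Nt A], h (Apply rs) # w) \<in> rules"
| permit: "(rs, Some p, None) \<in> sM G \<Longrightarrow> ([], Apply [], p, h (Apply rs) # p) \<in> rules"
| free: "(rs, None, None) \<in> sM G \<Longrightarrow> ([], Apply [], [], [h (Apply rs)]) \<in> rules"
| check: "(rs, None, Some [s]) \<in> sM G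
    \<Longrightarrow> ([h LeftEnd], Apply [], [], [h LeftEnd, h (Check s rs)]) \<in> rules"
| check_right: "(rs, None, Some [s]) \<in> sM G \<Longrightarrow> s' \<in> V \<Longrightarrow> s' \<noteq> s
    \<Longrightarrow> ([], Check s rs, [s'], [s', h (Check s rs)]) \<in> rules"
| check_end: "(rs, None, Some [s]) \<in> sM G
    \<Longrightarrow> ([], Check s rs, [h RightEnd], [h (Apply rs), h RightEnd]) \<in> rules"
| out: "([h LeftEnd], Apply [], [], [h Out]) \<in> rules"
| out_right: "a \<in> sT G \<Longrightarrow> ([], Out, [Tm a], [Tm a, h Out]) \<in> rules"
| out_end: "([], Out, [h RightEnd], []) \<in> rules"

definition H :: "'t psg" where
  "H = \<lparr>gT = sT G, gN = sN G \<union> q ` Q, gS = q Init,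
        gR = (\<lambda>(a, s, b, c). (a @ [h s] @ b, c)) ` rules\<rparr>"

lemma ApplyNil_Q [simp]: "Apply [] \<in> Q" "Init \<in> Q" "LeftEnd \<in> Q" "RightEnd \<in> Q" "Out \<in> Q"
  by (auto simp: Q_def)

lemma Apply_suffix_Q: "Apply (x # rs) \<in> Q \<Longrightarrow> Apply rs \<in> Q"
proof -
  assume "Apply (x # rs) \<in> Q"
  then obtain rs' P F where "(rs', P, F) \<in> sM G" "suffix (x # rs) rs'"
    unfolding Q_def by (auto split: option.splits)
  moreover from this have "rs \<in> set (suffixes rs')" using suffix_ConsD[of x rs rs'] by simp
  ultimately show ?thesis unfolding Q_def by blast
qed

lemma Apply_matrix_Q: "(rs, P, F) \<in> sM G \<Longrightarrow> Apply rs \<in> Q"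
  unfolding Q_def by fastforce

lemma Check_matrix_Q: "(rs, None, Some [s]) \<in> sM G \<Longrightarrow> Check s rs \<in> Q"
  unfolding Q_def by force

lemma matrix_V:
  assumes "(rs, P, F) \<in> sM G"
  shows "\<And>A w. (A, w) \<in> set rs \<Longrightarrow> A \<in> sN G \<and> set w \<subseteq> V"
    "P = Some p \<Longrightarrow> set p \<subseteq> V \<and> p \<noteq> []" "F = Some f \<Longrightarrow> set f \<subseteq> V \<and> f \<noteq> []"
  using assms wf unfolding scm_wf_def by fastforce+

lemma Apply_V: "Apply ((A, w) # rs) \<in> Q \<Longrightarrow> A \<in> sN G \<and> set w \<subseteq> V"
proof -
  assume "Apply ((A, w) # rs) \<in> Q"
  then obtain rs' P F where "(rs', P, F) \<in> sM G" "suffix ((A, w) # rs) rs'"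
    unfolding Q_def by (auto split: option.splits)
  then show ?thesis using matrix_V(1)[of rs' P F A w] set_mono_suffix[of "(A, w) # rs" rs'] by auto
qed

lemma finite_Q: "finite Q"
  using wf unfolding Q_def scm_wf_def by (auto split: option.splits)

lemma h_notin_V: "s \<in> Q \<Longrightarrow> h s \<notin> V"
  using q_fresh by (auto simp: scm_V_def)

lemma h_eq: "s \<in> Q \<Longrightarrow> t \<in> Q \<Longrightarrow> h s = h t \<longleftrightarrow> s = t"
  using q_inj by (auto simp: inj_on_def)

lemma rules_active: "(a, s, b, c) \<in> rules \<Longrightarrow> s \<in> active"
  by (erule rules.cases) (auto simp: active_def Check_matrix_Q)

lemma V_simps: "Nt A \<in> V \<longleftrightarrow> A \<in> sN G" "Tm a \<in> V \<longleftrightarrow> a \<in> sT G"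
  by (auto simp: scm_V_def)

lemma rules_lhs:
  "(a, s, b, c) \<in> rules \<Longrightarrow> set a \<union> set b \<subseteq> V \<union> {h LeftEnd, h RightEnd}"
  by (erule rules.cases) (auto dest: matrix_V Apply_V simp: V_simps)

lemma rules_rhs: "(a, s, b, c) \<in> rules \<Longrightarrow> set c \<subseteq> V \<union> h ` Q"
  using wf by (elim rules.cases)
   (auto dest: matrix_V Apply_V Apply_suffix_Q Apply_matrix_Q Check_matrix_Q simp: V_simps scm_wf_def)

lemma finite_rules: "finite rules"
proof -
  let ?B = "V \<union> h ` Q"
  have fV: "finite V" using wf by (auto simp: scm_V_def scm_wf_def)
  \<comment> \<open>Words that may exceed length 4 depend on one of finitely many matrices or heads:
    \<open>?ps\<close> holds the permitting words, \<open>?ws\<close> the right sides of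
    \<open>app\<close> and \<open>?pr\<close> those of \<open>permit\<close>. The bound 4 is
    attained by \<open>start\<close>.\<close>
  let ?ps = "(\<lambda>(rs, P, F). case P of None \<Rightarrow> [] | Some p \<Rightarrow> p) ` sM G"
  let ?ws = "(\<lambda>s. case s of Apply ((A, w) # rs) \<Rightarrow> h (Apply rs) # w | _ \<Rightarrow> []) ` Q"
  let ?short = "{xs. set xs \<subseteq> ?B \<and> length xs \<le> 4}"
  let ?pr = "(\<lambda>(s, p). s # p) ` (?B \<times> ?ps)"
  have fin: "finite (?short \<times> Q \<times> (?short \<union> ?ps) \<times> (?short \<union> ?ps \<union> ?ws \<union> ?pr))"
    using fV finite_Q wf by (intro finite_cartesian_product finite_UnI finite_lists_length_le finite_imageI) (auto simp: scm_wf_def)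
  show ?thesis
  proof (rule finite_subset[OF _ fin], rule subsetI)
    fix x assume x: "x \<in> rules"
    obtain a s b c where abc: "x = (a, s, b, c)" by (cases x)
    have r: "(a, s, b, c) \<in> rules" using x abc by simp
    have Q: "s \<in> Q" "set a \<subseteq> ?B" "set b \<subseteq> ?B" "set c \<subseteq> ?B"
      using rules_active[OF r] rules_lhs[OF r] rules_rhs[OF r] by (auto simp: active_def)
    have "length a \<le> 4" using r by cases auto
    moreover have "length b \<le> 4 \<or> b \<in> ?ps" using r by cases force+
    moreover have "length c \<le> 4 \<or> c \<in> ?ps \<union> ?ws \<union> ?pr"
      using r
    proof cases
      case (app A w rs)
      then show ?thesis by (intro disjI2 UnI1 UnI2) (rule image_eqI[of _ _ s], auto)
    next
      case (permit rs)
      then have "b \<in> ?ps" "h (Apply rs) \<in> ?B" using Apply_matrix_Q by force+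
      then show ?thesis using permit by (intro disjI2 UnI2) (rule image_eqI[of _ _ "(h (Apply rs), b)"], auto)
    qed auto
    ultimately show "x \<in> ?short \<times> Q \<times> (?short \<union> ?ps) \<times> (?short \<union> ?ps \<union> ?ws \<union> ?pr)"
      using Q unfolding abc by blast
  qed
qed

lemma H_wf: "psg_wf H"
proof -
  have V: "psg_V H = V \<union> h ` Q" by (auto simp: psg_V_def H_def scm_V_def)
  have "set (a @ [h s] @ b) \<subseteq> psg_V H \<and> set c \<subseteq> psg_V H \<and> (\<exists>A \<in> gN H. Nt A \<in> set (a @ [h s] @ b))"
    if "(a, s, b, c) \<in> rules" for a s b c
    using rules_lhs[OF that] rules_rhs[OF that] rules_active[OF that]
    unfolding V by (auto simp: active_def H_def)
  then have "\<forall>(x, c) \<in> (\<lambda>(a, s, b, c). (a @ [h s] @ b, c)) ` rules.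
      set x \<subseteq> psg_V H \<and> set c \<subseteq> psg_V H \<and> (\<exists>A \<in> gN H. Nt A \<in> set x)"
    unfolding ball_simps(9) by (auto simp only: split_conv) blast+
  moreover have "gR H = (\<lambda>(a, s, b, c). (a @ [h s] @ b, c)) ` rules" by (simp add: H_def)
  moreover have "finite (gT H)" "finite (gN H)" "gS H \<in> gN H" "finite (gR H)"
    using wf finite_rules finite_Q by (auto simp: H_def scm_wf_def)
  ultimately show ?thesis unfolding psg_wf_def by simp
qed

lemma H_stepI:
  assumes "(a, s, b, c) \<in> rules"
  shows "psg_step H (u @ a @ h s # b @ v) (u @ c @ v)"
proof -
  have "(a @ [h s] @ b, c) \<in> gR H" unfolding H_def using assms by (auto intro!: image_eqI[of _ _ "(a, s, b, c)"])
  then show ?thesis unfolding psg_step_def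
    by (rule bexI[rotated]) (simp, rule exI[of _ u], rule exI[of _ v], simp)
qed

lemma no_active:
  assumes "set x \<subseteq> V \<union> {h LeftEnd, h RightEnd}" shows "\<forall>t \<in> active. h t \<notin> set x"
proof (intro ballI notI)
  fix t assume "t \<in> active" "h t \<in> set x"
  then have "t \<in> Q" "t \<noteq> LeftEnd" "t \<noteq> RightEnd" "h t \<in> V \<union> {h LeftEnd, h RightEnd}"
    using assms by (auto simp: active_def)
  then show False using h_notin_V[of t] h_eq[of t LeftEnd] h_eq[of t RightEnd] by simp
qed

text \<open>Each left side contains an active head, and \<open>l\<close> and \<open>r\<close>
  contain none. So the rule must match the given head, and its two contexts are a suffix of
  \<open>l\<close> and a prefix of \<open>r\<close>.\<close>

lemma H_step_active:
  assumes "psg_step H (l @ h s # r) y" "s \<in> active" "set (l @ r) \<subseteq> V \<union> {h LeftEnd, h RightEnd}"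
  obtains a b c l' r' where "(a, s, b, c) \<in> rules" "l = l' @ a" "r = b @ r'" "y = l' @ c @ r'"
proof -
  from assms(1) obtain a t b c u v where r: "(a, t, b, c) \<in> rules"
    and eq: "l @ h s # r = u @ (a @ [h t] @ b) @ v" and y: "y = u @ c @ v"
    unfolding psg_step_def H_def by auto
  have t: "t \<in> active" by (rule rules_active[OF r])
  have "h t \<in> set (l @ h s # r)" unfolding eq by simp
  with no_active[OF assms(3)] t have "h t = h s" by auto
  then have "t = s" using t assms(2) h_eq by (auto simp: active_def)
  have "l @ h s # r = (u @ a) @ h s # (b @ v)" using eq \<open>t = s\<close> by simp
  then have "l = u @ a" "r = b @ v" using assms(2) no_active[OF assms(3)] append_Cons_eq_iff[of "h s" l r "u @ a" "b @ v"] by auto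
  with r \<open>t = s\<close> y that show ?thesis by blast
qed

section \<open>Soundness: an invariant for the forms of the phrase-structure grammar\<close>

abbreviation derivable :: "'t sym list \<Rightarrow> bool" where
  "derivable y \<equiv> (scm_step G)\<^sup>*\<^sup>* [Nt (sS G)] y"

text \<open>While a matrix is being executed, the current word itself need not be derivable;
  \<open>f_apply\<close> therefore speaks of all outcomes of the pending rules, which for
  \<open>rs = []\<close> is derivability of \<open>u @ v\<close>. In \<open>f_check\<close> and
  \<open>f_out\<close> the part left of the head has already passed its test.\<close>

inductive form :: "'t sym list \<Rightarrow> bool" where
  f_init: "form [h Init]"
| f_apply: "Apply rs \<in> Q \<Longrightarrow> set u \<subseteq> V \<Longrightarrow> set v \<subseteq> V \<Longrightarrow> (\<And>y. rewrite_seq rs (u @ v) y \<Longrightarrow> derivable y)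
    \<Longrightarrow> form (h LeftEnd # u @ h (Apply rs) # v @ [h RightEnd])"
| f_check: "(rs, None, Some [s]) \<in> sM G \<Longrightarrow> set u \<subseteq> V \<Longrightarrow> set v \<subseteq> V \<Longrightarrow> s \<notin> set u \<Longrightarrow> derivable (u @ v)
    \<Longrightarrow> form (h LeftEnd # u @ h (Check s rs) # v @ [h RightEnd])"
| f_out: "set w \<subseteq> sT G \<Longrightarrow> set v \<subseteq> V \<Longrightarrow> derivable (map Tm w @ v)
    \<Longrightarrow> form (map Tm w @ h Out # v @ [h RightEnd])"
| f_done: "derivable (map Tm w) \<Longrightarrow> form (map Tm w)"

lemma derivable_step: "derivable x \<Longrightarrow> r \<in> sM G \<Longrightarrow> matrix_step r x y \<Longrightarrow> derivable y"
  by (rule rtranclp.rtrancl_into_rtrancl) (auto simp: scm_step_def)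

lemma V_RightEnd_split:
  assumes "v @ [h RightEnd] = p @ r'" "set p \<subseteq> V"
  obtains v' where "v = p @ v'" "r' = v' @ [h RightEnd]"
proof (cases r' rule: rev_cases)
  case Nil
  then have "h RightEnd \<in> set p" using assms(1) by (metis append_Nil2 in_set_conv_decomp)
  then show ?thesis using assms(2) h_notin_V[of RightEnd] by auto
next
  case (snoc ys y)
  then show ?thesis using assms(1) that[of ys] by simp
qed

lemma form_step:
  assumes "form z" "psg_step H z y" shows "form y"
  using assms(1)
proof cases
  case f_init
  have "psg_step H ([] @ h Init # []) y" using assms(2) f_init by simp
  then obtain a b c l' r' where r: "(a, Init, b, c) \<in> rules" "[] = l' @ a" "[] = b @ r'" "y = l' @ c @ r'"
    by (rule H_step_active) (auto simp: active_def)
  from r(1) have "c = [h LeftEnd, h (Apply []), Nt (sS G), h RightEnd]" by cases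
  then have "y = h LeftEnd # [] @ h (Apply []) # [Nt (sS G)] @ [h RightEnd]" using r by simp
  moreover have "Nt (sS G) \<in> V" using wf by (auto simp: scm_wf_def scm_V_def)
  ultimately show ?thesis using form.f_apply[of "[]" "[]" "[Nt (sS G)]"] by simp
next
  case (f_apply rs u v)
  have "psg_step H ((h LeftEnd # u) @ h (Apply rs) # (v @ [h RightEnd])) y" using assms(2) f_apply by simp
  then obtain a b c l' r' where r: "(a, Apply rs, b, c) \<in> rules" "h LeftEnd # u = l' @ a" "v @ [h RightEnd] = b @ r'"
    "y = l' @ c @ r'"
    by (rule H_step_active) (use f_apply in \<open>auto simp: active_def\<close>)
  from r(1) show ?thesis
  proof cases
    case (right s)
    obtain v' where v': "v = [s] @ v'" "r' = v' @ [h RightEnd]"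
      using V_RightEnd_split[of v "[s]" r'] r right by auto
    then have "y = h LeftEnd # (u @ [s]) @ h (Apply rs) # v' @ [h RightEnd]" using r right by simp
    then show ?thesis using form.f_apply[of rs "u @ [s]" v'] f_apply v' by auto
  next
    case (left s)
    have "s \<noteq> h LeftEnd" using left h_notin_V[of LeftEnd] by auto
    then obtain u' where u': "u = u' @ [s]" "l' = h LeftEnd # u'" using r(2) left by (cases l') auto
    then have "y = h LeftEnd # u' @ h (Apply rs) # (s # v) @ [h RightEnd]" using r left by simp
    then show ?thesis using form.f_apply[of rs u' "s # v"] f_apply u' left by auto
  next
    case (app A w rs')
    have Aw: "A \<in> sN G" "set w \<subseteq> V" using Apply_V app by auto
    then obtain v' where v': "v = [Nt A] @ v'" "r' = v' @ [h RightEnd]"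
      using V_RightEnd_split[of v "[Nt A]" r'] r app by (auto simp: V_simps)
    have "y = h LeftEnd # u @ h (Apply rs') # (w @ v') @ [h RightEnd]" using r app v' by simp
    moreover have "derivable y" if "rewrite_seq rs' (u @ w @ v') y" for y
      using f_apply(5)[of y] that v' app by auto
    ultimately show ?thesis using form.f_apply[of rs' u "w @ v'"] f_apply v' Aw Apply_suffix_Q app by auto
  next
    case (permit rs')
    have D: "derivable (u @ v)" using f_apply permit by auto
    obtain v' where v': "v = b @ v'" "r' = v' @ [h RightEnd]"
      using V_RightEnd_split[of v b r'] r permit matrix_V(2)[OF permit(4)] by auto
    have "y = h LeftEnd # u @ h (Apply rs') # v @ [h RightEnd]" using r permit v' by simp
    \<comment> \<open>The head stands directly before the permitting word, so the condition holds
      for \<open>u @ v\<close>, the word on which the matrix starts.\<close>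
    moreover have "derivable y" if "rewrite_seq rs' (u @ v) y" for y
      using D permit(4) by (rule derivable_step) (use that v' in \<open>auto simp: matrix_step_def sublist_def\<close>)
    ultimately show ?thesis using form.f_apply[of rs' u v] f_apply Apply_matrix_Q[OF permit(4)] by auto
  next
    case (free rs')
    have D: "derivable (u @ v)" using f_apply free by auto
    have "y = h LeftEnd # u @ h (Apply rs') # v @ [h RightEnd]" using r free by auto
    moreover have "derivable y" if "rewrite_seq rs' (u @ v) y" for y
      using D free(5) by (rule derivable_step) (use that in \<open>auto simp: matrix_step_def\<close>)
    ultimately show ?thesis using form.f_apply[of rs' u v] f_apply Apply_matrix_Q[OF free(5)] by auto
  next
    case (check rs' s)
    have D: "derivable (u @ v)" using f_apply check by auto
    \<comment> \<open>The rule requires \<open>LeftEnd\<close> directly before the head, so the scan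
      starts with the whole word ahead of it.\<close>
    have u: "u = []" "l' = []" using r(2) check f_apply(3) h_notin_V[of LeftEnd]
      by (cases l'; auto)+
    then have "y = h LeftEnd # u @ h (Check s rs') # v @ [h RightEnd]" using r check by auto
    then show ?thesis using form.f_check[of rs' s u v] f_apply check D u by auto
  next
    case out
    have D: "derivable (u @ v)" using f_apply out by auto
    have u: "u = []" "l' = []" using r(2) out f_apply(3) h_notin_V[of LeftEnd]
      by (cases l'; auto)+
    then have "y = map Tm [] @ h Out # v @ [h RightEnd]" using r out by auto
    then show ?thesis using form.f_out[of "[]" v] f_apply D u by auto
  qed
next
  case (f_check rs s u v)
  have "psg_step H ((h LeftEnd # u) @ h (Check s rs) # (v @ [h RightEnd])) y" using assms(2) f_check by simp
  then obtain a b c l' r' where r: "(a, Check s rs, b, c) \<in> rules" "h LeftEnd # u = l' @ a" "v @ [h RightEnd] = b @ r'"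
    "y = l' @ c @ r'"
    by (rule H_step_active)
      (use f_check Check_matrix_Q in \<open>auto simp: active_def\<close>)
  from r(1) show ?thesis
  proof cases
    case (check_right s')
    obtain v' where v': "v = [s'] @ v'" "r' = v' @ [h RightEnd]"
      using V_RightEnd_split[of v "[s']" r'] r check_right by auto
    then have "y = h LeftEnd # (u @ [s']) @ h (Check s rs) # v' @ [h RightEnd]" using r check_right by simp
    then show ?thesis using form.f_check[of rs s "u @ [s']" v'] f_check v' check_right by auto
  next
    case check_end
    \<comment> \<open>The scan stops only at \<open>RightEnd\<close>; then \<open>u\<close> is the
      whole word and is free of \<open>s\<close>.\<close>
    have v: "v = []" "r' = []" using r(3) check_end f_check(4) h_notin_V[of RightEnd]
      by (cases v; auto)+
    have "y = h LeftEnd # u @ h (Apply rs) # [] @ [h RightEnd]" using r check_end v by auto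
    moreover have "derivable y" if "rewrite_seq rs (u @ []) y" for y
      using f_check(6,2) by (rule derivable_step)
        (use that v f_check in \<open>auto simp: matrix_step_def sublist_singleton\<close>)
    ultimately show ?thesis using form.f_apply[of rs u "[]"] f_check Apply_matrix_Q by auto
  qed
next
  case (f_out w v)
  have Tw: "set (map Tm w) \<subseteq> V" using f_out by (auto simp: V_simps)
  have "psg_step H (map Tm w @ h Out # (v @ [h RightEnd])) y" using assms(2) f_out by simp
  then obtain a b c l' r' where r: "(a, Out, b, c) \<in> rules" "map Tm w = l' @ a" "v @ [h RightEnd] = b @ r'"
    "y = l' @ c @ r'"
    by (rule H_step_active)
      (use Tw f_out in \<open>auto simp: active_def\<close>)
  from r(1) show ?thesis
  proof cases
    case (out_right x)
    obtain v' where v': "v = [Tm x] @ v'" "r' = v' @ [h RightEnd]"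
      using V_RightEnd_split[of v "[Tm x]" r'] r out_right by (auto simp: V_simps)
    then have "y = map Tm (w @ [x]) @ h Out # v' @ [h RightEnd]" using r out_right by simp
    then show ?thesis using form.f_out[of "w @ [x]" v'] f_out v' out_right by auto
  next
    case out_end
    have v: "v = []" "r' = []" using r(3) out_end f_out(3) h_notin_V[of RightEnd]
      by (cases v; auto)+
    have "y = map Tm w" using r out_end v by auto
    then show ?thesis using form.f_done[of w] f_out v by auto
  qed
next
  case (f_done w)
  from assms(2) obtain a s b c u v where "z = u @ (a @ [h s] @ b) @ v"
    unfolding psg_step_def H_def by auto
  then have "h s \<in> set z" by simp
  then show ?thesis using f_done by auto
qed

lemma H_lang_subset: "psg_lang H \<subseteq> scm_lang G"
proof
  fix w assume "w \<in> psg_lang H"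
  then have w: "set w \<subseteq> sT G" and d: "(psg_step H)\<^sup>*\<^sup>* [h Init] (map Tm w)"
    by (auto simp: psg_lang_def H_def)
  from d have "form (map Tm w)" by induction (auto intro: form.f_init form_step)
  then have "derivable (map Tm w)"
  proof cases
    case (f_done w')
    then show ?thesis by simp
  \<comment> \<open>All other forms contain a head, hence are not terminal words.\<close>
  qed (auto simp: map_eq_append_conv Cons_eq_map_conv map_eq_Cons_conv)
  with w show "w \<in> scm_lang G" by (simp add: scm_lang_def)
qed

section \<open>Completeness: the head executes a derivation of the matrix grammar\<close>

lemma move_right:
  "set v \<subseteq> V \<Longrightarrow> Apply rs \<in> Q \<Longrightarrow> (psg_step H)\<^sup>*\<^sup>* (x @ h (Apply rs) # v @ z) (x @ v @ h (Apply rs) # z)"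
proof (induction v arbitrary: x)
  case (Cons s v)
  have "psg_step H (x @ h (Apply rs) # (s # v) @ z) ((x @ [s]) @ h (Apply rs) # v @ z)"
    using H_stepI[OF rules.right[of rs s], of x "v @ z"] Cons.prems by simp
  also have "(psg_step H)\<^sup>*\<^sup>* ((x @ [s]) @ h (Apply rs) # v @ z) ((x @ [s]) @ v @ h (Apply rs) # z)"
    by (rule Cons.IH) (use Cons.prems in auto)
  finally show ?case by simp
qed simp

lemma move_left:
  "set v \<subseteq> V \<Longrightarrow> Apply rs \<in> Q \<Longrightarrow> (psg_step H)\<^sup>*\<^sup>* (x @ v @ h (Apply rs) # z) (x @ h (Apply rs) # v @ z)"
proof (induction v arbitrary: z rule: rev_induct)
  case (snoc s v)
  have "psg_step H (x @ (v @ [s]) @ h (Apply rs) # z) (x @ v @ h (Apply rs) # (s # z))"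
    using H_stepI[OF rules.left[of rs s], of "x @ v" z] snoc.prems by simp
  also have "(psg_step H)\<^sup>*\<^sup>* (x @ v @ h (Apply rs) # (s # z)) (x @ h (Apply rs) # v @ (s # z))"
    by (rule snoc.IH) (use snoc.prems in auto)
  finally show ?case by simp
qed simp

lemma check_scan:
  "set v \<subseteq> V \<Longrightarrow> s \<notin> set v \<Longrightarrow> (rs, None, Some [s]) \<in> sM G
   \<Longrightarrow> (psg_step H)\<^sup>*\<^sup>* (x @ h (Check s rs) # v @ z) (x @ v @ h (Check s rs) # z)"
proof (induction v arbitrary: x)
  case (Cons s' v)
  have "psg_step H (x @ h (Check s rs) # (s' # v) @ z) ((x @ [s']) @ h (Check s rs) # v @ z)"
    using H_stepI[OF rules.check_right[of rs s s'], of x "v @ z"] Cons.prems by auto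
  also have "(psg_step H)\<^sup>*\<^sup>* ((x @ [s']) @ h (Check s rs) # v @ z) ((x @ [s']) @ v @ h (Check s rs) # z)"
    by (rule Cons.IH) (use Cons.prems in auto)
  finally show ?case by simp
qed simp

lemma out_scan:
  "set w \<subseteq> sT G \<Longrightarrow> (psg_step H)\<^sup>*\<^sup>* (x @ h Out # map Tm w @ z) (x @ map Tm w @ h Out # z)"
proof (induction w arbitrary: x)
  case (Cons a w)
  have "psg_step H (x @ h Out # map Tm (a # w) @ z) ((x @ [Tm a]) @ h Out # map Tm w @ z)"
    using H_stepI[OF rules.out_right[of a], of x "map Tm w @ z"] Cons.prems by auto
  also have "(psg_step H)\<^sup>*\<^sup>* ((x @ [Tm a]) @ h Out # map Tm w @ z) ((x @ [Tm a]) @ map Tm w @ h Out # z)"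
    by (rule Cons.IH) (use Cons.prems in auto)
  finally show ?case by simp
qed simp

text \<open>The head is parked at the left end, so that every simulated rule and matrix starts and
  ends at the same place.\<close>

definition conf :: "(nat \<times> 't sym list) list \<Rightarrow> 't sym list \<Rightarrow> 't sym list" where
  "conf rs x = h LeftEnd # h (Apply rs) # x @ [h RightEnd]"

text \<open>For each rule the head walks to the chosen occurrence, rewrites it and walks
  back.\<close>

lemma rewrite_seq_simulated:
  "rewrite_seq rs x y \<Longrightarrow> Apply rs \<in> Q \<Longrightarrow> set x \<subseteq> V
   \<Longrightarrow> (psg_step H)\<^sup>*\<^sup>* (conf rs x) (conf [] y) \<and> set y \<subseteq> V"
proof (induction rs arbitrary: x)
  case (Cons r rs)
  obtain A w where r: "r = (A, w)" by (cases r)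
  from Cons.prems r obtain u v where x: "x = u @ [Nt A] @ v" and y: "rewrite_seq rs (u @ w @ v) y" by auto
  have Q': "Apply rs \<in> Q" and Aw: "set w \<subseteq> V" using Apply_suffix_Q Apply_V Cons.prems r by blast+
  have "(psg_step H)\<^sup>*\<^sup>* (conf (r # rs) x) (h LeftEnd # u @ h (Apply (r # rs)) # Nt A # v @ [h RightEnd])"
    using move_right[of u "r # rs" "[h LeftEnd]" "Nt A # v @ [h RightEnd]"] Cons.prems
    by (simp add: conf_def x)
  also have "psg_step H (h LeftEnd # u @ h (Apply (r # rs)) # Nt A # v @ [h RightEnd])
      (h LeftEnd # u @ h (Apply rs) # w @ v @ [h RightEnd])"
    using H_stepI[OF rules.app, of A w rs "h LeftEnd # u" "v @ [h RightEnd]"] Cons.prems r by simp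
  also have "(psg_step H)\<^sup>*\<^sup>* (h LeftEnd # u @ h (Apply rs) # w @ v @ [h RightEnd]) (conf rs (u @ w @ v))"
    using move_left[of u rs "[h LeftEnd]" "w @ v @ [h RightEnd]"] Cons.prems Q' x by (simp add: conf_def)
  finally show ?case using Cons.IH[OF y Q'] Cons.prems x Aw by (auto intro: rtranclp_trans)
qed auto

lemma scm_step_simulated:
  assumes "scm_step G x y" "set x \<subseteq> V"
  shows "(psg_step H)\<^sup>*\<^sup>* (conf [] x) (conf [] y) \<and> set y \<subseteq> V"
proof -
  from assms(1) obtain rs P F where m: "(rs, P, F) \<in> sM G" and st: "matrix_step (rs, P, F) x y"
    unfolding scm_step_def by auto
  have rw: "rewrite_seq rs x y" using st by (simp add: matrix_step_def)
  have "(psg_step H)\<^sup>*\<^sup>* (conf [] x) (conf rs x)"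
  proof (cases P)
    case None
    show ?thesis
    proof (cases F)
      case None
      have "psg_step H ([h LeftEnd] @ [] @ h (Apply []) # [] @ x @ [h RightEnd]) ([h LeftEnd] @ [h (Apply rs)] @ x @ [h RightEnd])"
        by (rule H_stepI, rule rules.free) (use m \<open>P = None\<close> None in simp)
      then show ?thesis by (simp add: conf_def)
    next
      case (Some f)
      \<comment> \<open>Degree one and nonemptiness leave a single forbidden symbol, whose absence
        can be tested by one scan.\<close>
      have "length f = 1" using forbid_short[OF m] matrix_V(3)[OF m Some] Some
        by (cases f) (auto simp: olen_def)
      then obtain s where f: "f = [s]" by (cases f) auto
      have m': "(rs, None, Some [s]) \<in> sM G" using m None Some f by simp
      have s: "s \<notin> set x" using st Some f by (simp add: matrix_step_def sublist_singleton split: option.splits)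
      have "psg_step H (conf [] x) ([h LeftEnd] @ h (Check s rs) # x @ [h RightEnd])"
        using H_stepI[OF rules.check[OF m'], of "[]" "x @ [h RightEnd]"] by (simp add: conf_def)
      also have "(psg_step H)\<^sup>*\<^sup>* \<dots> ([h LeftEnd] @ x @ h (Check s rs) # [h RightEnd])"
        by (rule check_scan) (use assms(2) s m' in auto)
      also have "psg_step H \<dots> ([h LeftEnd] @ x @ h (Apply rs) # [h RightEnd])"
        using H_stepI[OF rules.check_end[OF m'], of "h LeftEnd # x" "[]"] by simp
      also have "(psg_step H)\<^sup>*\<^sup>* \<dots> (conf rs x)"
        using move_left[of x rs "[h LeftEnd]" "[h RightEnd]"] assms(2) Apply_matrix_Q[OF m]
        by (simp add: conf_def)
      finally show ?thesis .
    qed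
  next
    case (Some p)
    then have m': "(rs, Some p, None) \<in> sM G" using simple[OF m] m by auto
    obtain u v where x: "x = u @ p @ v" using st Some by (auto simp: matrix_step_def sublist_def)
    have "(psg_step H)\<^sup>*\<^sup>* (conf [] x) ([h LeftEnd] @ u @ h (Apply []) # p @ v @ [h RightEnd])"
      using move_right[of u "[]" "[h LeftEnd]" "p @ v @ [h RightEnd]"] assms(2) x by (simp add: conf_def)
    also have "psg_step H \<dots> ([h LeftEnd] @ u @ h (Apply rs) # p @ v @ [h RightEnd])"
      using H_stepI[OF rules.permit[OF m'], of "h LeftEnd # u" "v @ [h RightEnd]"] by simp
    also have "(psg_step H)\<^sup>*\<^sup>* \<dots> (conf rs x)"
      using move_left[of u rs "[h LeftEnd]" "p @ v @ [h RightEnd]"] assms(2) Apply_matrix_Q[OF m] x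
      by (simp add: conf_def)
    finally show ?thesis .
  qed
  with rewrite_seq_simulated[OF rw Apply_matrix_Q[OF m] assms(2)] show ?thesis
    by (auto intro: rtranclp_trans)
qed

lemma scm_lang_subset: "scm_lang G \<subseteq> psg_lang H"
proof
  fix w assume "w \<in> scm_lang G"
  then have w: "set w \<subseteq> sT G" and d: "derivable (map Tm w)" by (auto simp: scm_lang_def)
  have S: "Nt (sS G) \<in> V" using wf by (auto simp: scm_wf_def scm_V_def)
  have "(psg_step H)\<^sup>*\<^sup>* (conf [] [Nt (sS G)]) (conf [] y) \<and> set y \<subseteq> V" if "derivable y" for y
    using that by induction (use S scm_step_simulated in \<open>auto intro: rtranclp_trans\<close>)
  note * = this[OF d]
  have "psg_step H [h Init] (conf [] [Nt (sS G)])"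
    using H_stepI[OF rules.start, of "[]" "[]"] by (simp add: conf_def)
  also have "(psg_step H)\<^sup>*\<^sup>* \<dots> (conf [] (map Tm w))" using * by simp
  also have "psg_step H \<dots> (h Out # map Tm w @ [h RightEnd])"
    using H_stepI[OF rules.out, of "[]" "map Tm w @ [h RightEnd]"] by (simp add: conf_def)
  also have "(psg_step H)\<^sup>*\<^sup>* \<dots> (map Tm w @ h Out # [h RightEnd])"
    using out_scan[OF w, of "[]" "[h RightEnd]"] by simp
  also have "psg_step H \<dots> (map Tm w)"
    using H_stepI[OF rules.out_end, of "map Tm w" "[]"] by simp
  finally show "w \<in> psg_lang H" using w by (simp add: psg_lang_def H_def)
qed

lemma scm_lang_RE: "is_RE (scm_lang G)"
  unfolding is_RE_def using H_wf H_lang_subset scm_lang_subset by blast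

end

theorem simple_scm_lang_RE:
  assumes "in_SSCM i 1 n m l G"
  shows "is_RE (scm_lang G)"
proof -
  have wf: "scm_wf G" and F: "\<And>rs P F. (rs, P, F) \<in> sM G \<Longrightarrow> olen F \<le> 1"
    and ns: "card {r \<in> sM G. nonsimple r} \<le> 0"
    using assms unfolding in_SSCM_def in_SCM_def by auto
  have simple: "P = None \<or> F = None" if "(rs, P, F) \<in> sM G" for rs P F
  proof -
    have "{r \<in> sM G. nonsimple r} = {}" using ns wf by (simp add: scm_wf_def)
    with that show ?thesis by (auto simp: nonsimple_def)
  qed
  define Q where "Q = {Init, LeftEnd, RightEnd, Out, Apply []}
      \<union> (\<Union>(rs, P, F) \<in> sM G. Apply ` set (suffixes rs) \<union> (case F of None \<Rightarrow> {} | Some f \<Rightarrow> {Check (hd f) rs}))"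
  have "finite Q" using wf unfolding Q_def scm_wf_def by (auto split: option.splits)
  then obtain f :: "'a head \<Rightarrow> nat" where f: "inj_on f Q" using finite_imp_inj_to_nat_seg by blast
  \<comment> \<open>Shifting past the largest nonterminal makes all heads fresh.\<close>
  define q where "q s = f s + Suc (Max (sN G))" for s
  have "q s \<notin> sN G" for s
  proof
    assume "q s \<in> sN G"
    then have "q s \<le> Max (sN G)" using wf by (intro Max_ge) (auto simp: scm_wf_def)
    then show False by (simp add: q_def)
  qed
  moreover have "inj_on q Q" using f by (auto simp: inj_on_def q_def)
  ultimately interpret simple_scm G q Q
    by unfold_locales (use wf F simple Q_def in auto)
  show ?thesis by (rule scm_lang_RE)
qed

section \<open>A prefix code without overlaps\<close>

text \<open>A semi-Thue step over an arbitrary alphabet; it serves both for words of bits and for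
  words of numbers.\<close>

definition st_step :: "('a list \<times> 'a list) set \<Rightarrow> 'a list \<Rightarrow> 'a list \<Rightarrow> bool" where
  "st_step R x y \<longleftrightarrow> (\<exists>(a, b) \<in> R. \<exists>u v. x = u @ a @ v \<and> y = u @ b @ v)"

lemma st_stepI: "(a, b) \<in> R \<Longrightarrow> st_step R (u @ a @ v) (u @ b @ v)"
  by (auto simp: st_step_def)

lemma st_step_context: "st_step R x y \<Longrightarrow> st_step R (p @ x @ q) (p @ y @ q)"
proof -
  assume "st_step R x y"
  then obtain a b u v where "(a, b) \<in> R" "x = u @ a @ v" "y = u @ b @ v" unfolding st_step_def by blast
  then show ?thesis using st_stepI[of a b R "p @ u" "v @ q"] by simp
qed

lemma st_steps_context:
  assumes "(st_step R)\<^sup>*\<^sup>* x y" shows "(st_step R)\<^sup>*\<^sup>* (p @ x @ q) (p @ y @ q)"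
  using assms by (induction) (auto intro: rtranclp.rtrancl_into_rtrancl st_step_context)

text \<open>A code word A(AB)...(AB)B contains AA only at its beginning, so occurrences of code words never
  overlap.\<close>

definition cd :: "nat \<Rightarrow> bool list" where
  "cd i = True # concat (replicate (Suc i) [True, False]) @ [False]"

definition cds :: "nat list \<Rightarrow> bool list" where
  "cds xs = concat (map cd xs)"

lemma cds_simps [simp]: "cds [] = []" "cds (x # xs) = cd x @ cds xs" "cds (xs @ ys) = cds xs @ cds ys"
  by (simp_all add: cds_def)

lemma cd_neq_Nil [simp]: "cd i \<noteq> []" by (simp add: cd_def)

lemma cd_begin: "cd i = True # True # False # concat (replicate i [True, False]) @ [False]"
  by (simp add: cd_def)

text \<open>A nonempty suffix of (AB)...(AB)B begins with B or with AB, whatever follows it.\<close>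

lemma alternating_suffix_no_double:
  assumes "concat (replicate n [True, False]) @ [False] = M @ N" "N \<noteq> []"
  shows "N @ C \<noteq> True # True # Q"
  using assms
proof (induction n arbitrary: M)
  case 0
  then show ?case by (cases M) auto
next
  case (Suc n)
  show ?case
  proof (cases M)
    case Nil
    with Suc.prems show ?thesis by (auto simp flip: Suc.prems(1))
  next
    case M: (Cons x M')
    show ?thesis
    proof (cases M')
      case Nil
      with Suc.prems M show ?thesis by auto
    next
      case (Cons y M'')
      with Suc.prems M have "concat (replicate n [True, False]) @ [False] = M'' @ N" by auto
      from Suc.IH[OF this Suc.prems(2)] show ?thesis .
    qed
  qed
qed

text \<open>Dropping at least the first A leaves a suffix of the alternating part. As every code
  word begins with AA, none can start strictly inside another, even if it would extend beyond its
  end.\<close>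

lemma cd_proper_suffix_no_double:
  assumes "cd i = M @ N" "M \<noteq> []" "N \<noteq> []"
  shows "N @ C \<noteq> True # True # Q"
proof -
  obtain M' where "concat (replicate (Suc i) [True, False]) @ [False] = M' @ N"
    using assms(1,2) unfolding cd_def by (cases M) auto
  then show ?thesis using alternating_suffix_no_double assms(3) by blast
qed

text \<open>Read in pairs, the word shows A at the start of each pair and B at the first position
  after the last pair; this B reveals the number of pairs.\<close>

lemma alternating_prefix_free:
  "concat (replicate k [True, False]) @ False # C = concat (replicate l [True, False]) @ False # Q
   \<Longrightarrow> k = l \<and> C = Q"
proof (induction k arbitrary: l)
  case 0
  then show ?case by (cases l) auto
next
  case (Suc k)
  then show ?case by (cases l) auto
qed

lemma cd_prefix_free: "cd k @ C = cd l @ Q \<Longrightarrow> k = l \<and> C = Q"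
  using alternating_prefix_free[of k C l Q] by (simp add: cd_begin)

text \<open>If \<open>cd l\<close> starts at the front, prefix-freeness applies; if it started
  inside \<open>cd k\<close>, a proper suffix of \<open>cd k\<close> would be continued by
  AA.\<close>

lemma cd_occurrence_right:
  assumes "cd k @ C = M @ cd l @ Q"
  shows "(\<exists>M'. M = cd k @ M' \<and> C = M' @ cd l @ Q) \<or> (M = [] \<and> k = l \<and> C = Q)"
proof (cases "M = []")
  case True
  then show ?thesis using cd_prefix_free[of k C l Q] assms by simp
next
  case False
  from iffD1[OF append_eq_append_conv2 assms] consider N where "cd k @ N = M" "C = N @ cd l @ Q" | N where "cd k = M @ N" "N @ C = cd l @ Q"
    by metis
  then show ?thesis
  proof cases
    case 2
    show ?thesis
    proof (cases "N = []")
      case True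
      with 2 show ?thesis by auto
    next
      case False
      from cd_proper_suffix_no_double[OF 2(1) \<open>M \<noteq> []\<close> this] 2(2) show ?thesis
        by (auto simp: cd_begin)
    qed
  qed auto
qed

lemma cd_occurrences:
  assumes "A @ cd k @ C = P @ cd l @ Q"
  shows "(\<exists>M. A = P @ cd l @ M \<and> Q = M @ cd k @ C) \<or> (\<exists>M. C = M @ cd l @ Q \<and> P = A @ cd k @ M) \<or> (k = l \<and> A = P \<and> C = Q)"
proof -
  from iffD1[OF append_eq_append_conv2 assms] consider M where "P = A @ M" "cd k @ C = M @ cd l @ Q"
    | M where "A = P @ M" "cd l @ Q = M @ cd k @ C"
    by metis
  then show ?thesis
  proof cases
    case 1
    with cd_occurrence_right[OF 1(2)] show ?thesis by auto
  next
    case 2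
    with cd_occurrence_right[OF 2(2)] show ?thesis by auto
  qed
qed

text \<open>The block is compared with \<open>cd k\<close> one code word at a time. Since code words
  do not overlap, \<open>cd k\<close> lies after the block, before it, or is one of its
  letters.\<close>

lemma cds_occurrences:
  assumes "A @ cd k @ C = P @ cds ls @ Q" "ls \<noteq> []"
  shows "(\<exists>M. A = P @ cds ls @ M \<and> Q = M @ cd k @ C) \<or> (\<exists>M. C = M @ cds ls @ Q \<and> P = A @ cd k @ M)
    \<or> (\<exists>l1 l2. ls = l1 @ k # l2 \<and> A = P @ cds l1 \<and> C = cds l2 @ Q)"
  using assms
proof (induction ls arbitrary: A P)
  case (Cons l ls)
  from Cons.prems have "A @ cd k @ C = P @ cd l @ (cds ls @ Q)" by simp
  from cd_occurrences[OF this] consider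
    M where "A = P @ cd l @ M" "cds ls @ Q = M @ cd k @ C"
    | M where "C = M @ cd l @ cds ls @ Q" "P = A @ cd k @ M" | "k = l" "A = P" "C = cds ls @ Q" by auto
  then show ?case
  proof cases
    case 1
    show ?thesis
    proof (cases "ls = []")
      case True
      with 1 show ?thesis by auto
    next
      case False
      have "M @ cd k @ C = [] @ cds ls @ Q" using 1 by simp
      from Cons.IH[OF this False] consider
        M' where "M = cds ls @ M'" "Q = M' @ cd k @ C"
        | l1 l2 where "ls = l1 @ k # l2" "M = cds l1" "C = cds l2 @ Q"
        by auto
      then show ?thesis
      proof cases
        case a: 1
        with 1 show ?thesis by auto
      next
        case b: 2
        have "l # ls = (l # l1) @ k # l2" "A = P @ cds (l # l1)" using 1 b by simp_all
        with b(3) show ?thesis by blast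
      qed
    qed
  next
    case 2
    then show ?thesis by auto
  next
    case 3
    then have "l # ls = [] @ k # ls \<and> A = P @ cds [] \<and> C = cds ls @ Q" by simp
    then show ?thesis by blast
  qed
qed simp

text \<open>Letters are split off by prefix-freeness; no code word fits into the final B, since it
  would begin with A.\<close>

lemma cds_prefix_decode:
  "cds ls @ Q = cds xs @ [False] \<Longrightarrow> \<exists>x2. xs = ls @ x2 \<and> Q = cds x2 @ [False]"
proof (induction ls arbitrary: xs)
  case (Cons l ls)
  show ?case
  proof (cases xs)
    case Nil
    with Cons.prems show ?thesis by (simp add: cd_begin)
  next
    case (Cons x xs')
    with Cons.prems have "cd l @ (cds ls @ Q) = cd x @ (cds xs' @ [False])" by simp
    then have "l = x" "cds ls @ Q = cds xs' @ [False]" using cd_prefix_free by blast+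
    with Cons.IH Cons show ?thesis by auto
  qed
qed simp

lemma cds_end_inj: "cds xs @ [False] = cds ys @ [False] \<Longrightarrow> xs = ys"
  using cds_prefix_decode[of xs "[False]" ys] by (auto simp: cds_def)

text \<open>Code blocks occur only at letter boundaries. Nonemptiness of \<open>ls\<close> is
  essential, as the empty word occurs everywhere.\<close>

lemma cds_aligned:
  assumes "cds xs @ [False] = P @ cds ls @ Q" "ls \<noteq> []"
  shows "\<exists>x1 x2. xs = x1 @ ls @ x2 \<and> P = cds x1 \<and> Q = cds x2 @ [False]"
  using assms
proof (induction xs arbitrary: P)
  case Nil
  then have "length [False] = length (P @ cds ls @ Q)" by simp
  moreover have "length (cds ls) \<ge> 2" using \<open>ls \<noteq> []\<close> by (cases ls) (auto simp: cd_begin)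
  ultimately show ?case by simp
next
  case (Cons x xs)
  have "[] @ cd x @ (cds xs @ [False]) = P @ cds ls @ Q" using Cons.prems by simp
  from cds_occurrences[OF this Cons.prems(2)] consider
     "ls \<noteq> []" "[] = P @ cds ls" | M where "cds xs @ [False] = M @ cds ls @ Q" "P = cd x @ M"
    | l1 l2 where "ls = l1 @ x # l2" "[] = P @ cds l1" "cds xs @ [False] = cds l2 @ Q"
    using Cons.prems(2) by auto
  then show ?case
  proof cases
    case 1
    then show ?thesis by (cases ls) auto
  next
    case 2
    from Cons.IH[OF 2(1) Cons.prems(2)] obtain x1 x2
      where "xs = x1 @ ls @ x2" "M = cds x1" "Q = cds x2 @ [False]" by blast
    with 2 have "x # xs = (x # x1) @ ls @ x2 \<and> P = cds (x # x1) \<and> Q = cds x2 @ [False]" by simp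
    then show ?thesis by blast
  next
    case 3
    have "l1 = []" using 3(2) by (cases l1) auto
    moreover obtain x2 where "xs = l2 @ x2" "Q = cds x2 @ [False]"
      using cds_prefix_decode[OF 3(3)[symmetric]] by blast
    ultimately have "x # xs = [] @ ls @ x2 \<and> P = cds [] \<and> Q = cds x2 @ [False]" using 3 by simp
    then show ?thesis by blast
  qed
qed

section \<open>Insertion and erasure systems\<close>

text \<open>A triple (a, b, r) is a rule a -> b with name \<open>r\<close>. Names are letters that
  occur in no rule side and determine their rule, so a name can be tracked through a
  derivation.\<close>

locale coded_rules =
  fixes R :: "(nat list \<times> nat list \<times> nat) set"
  assumes lhs_nonempty: "(a, b, r) \<in> R \<Longrightarrow> a \<noteq> []"
    and names_fresh: "(a, b, r) \<in> R \<Longrightarrow> (a', b', r') \<in> R \<Longrightarrow> r \<notin> set a' \<and> r \<notin> set b'"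
    and names_det: "(a, b, r) \<in> R \<Longrightarrow> (a', b', r) \<in> R \<Longrightarrow> a = a' \<and> b = b'"
begin

definition erasures :: "(bool list \<times> bool list) set" where
  "erasures = {(cds (a @ [r]), []) | a b r. (a, b, r) \<in> R}"
definition insertions :: "(bool list \<times> bool list) set" where
  "insertions = {([], cds (r # b)) | a b r. (a, b, r) \<in> R}"
text \<open>The net effect of inserting \<open>r b\<close> right after \<open>a\<close> and then
  erasing \<open>a r\<close>.\<close>

definition replacements :: "(bool list \<times> bool list) set" where
  "replacements = {(cds a, cds b) | a b r. (a, b, r) \<in> R}"

abbreviation "plain_rules \<equiv> {(a, b). \<exists>r. (a, b, r) \<in> R}"
abbreviation "ins_step \<equiv> st_step (erasures \<union> insertions)"
abbreviation "rep_step \<equiv> st_step (erasures \<union> replacements)"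

lemma erasuresI: "(a, b, r) \<in> R \<Longrightarrow> (cds (a @ [r]), []) \<in> erasures"
  unfolding erasures_def by blast

lemma insertionsI: "(a, b, r) \<in> R \<Longrightarrow> ([], cds (r # b)) \<in> insertions"
  unfolding insertions_def by blast

text \<open>Imposed on final words, this forces every inserted name to be erased at some
  time.\<close>

definition name_free :: "bool list \<Rightarrow> bool" where
  "name_free z \<longleftrightarrow> (\<forall>a b r P Q. (a, b, r) \<in> R \<longrightarrow> z \<noteq> P @ cd r @ Q)"

text \<open>An inserted name r disappears only by an erasure; until then, the words on its two sides
  evolve independently.\<close>

lemma name_consumed:
  assumes "rep_step\<^sup>*\<^sup>* (A @ cd r @ C) F" "(a, b, r) \<in> R" "name_free F"
  shows "\<exists>y z. rep_step\<^sup>*\<^sup>* A (y @ cds a) \<and> rep_step\<^sup>*\<^sup>* C z \<and> rep_step\<^sup>*\<^sup>* (y @ z) F"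
  using assms(1)
proof (induction "A @ cd r @ C" arbitrary: A C rule: converse_rtranclp_induct)
  case base
  with assms(2,3) show ?case unfolding name_free_def by blast
next
  case (step W)
  from step.hyps(1) obtain L M P Q where LM: "(L, M) \<in> erasures \<union> replacements"
    and eq: "A @ cd r @ C = P @ L @ Q" and W: "W = P @ M @ Q"
    unfolding st_step_def by blast
  \<comment> \<open>Every left side is a nonempty block of code words. It contains \<open>r\<close>
    only if it belongs to the erasure for \<open>r\<close>, because rule sides are free of
    names.\<close>
  obtain ls where ls: "L = cds ls" "ls \<noteq> []"
    and lsr: "r \<in> set ls \<Longrightarrow> \<exists>a' b'. (a', b', r) \<in> R \<and> ls = a' @ [r] \<and> r \<notin> set a' \<and> M = []"
  proof (cases "(L, M) \<in> erasures")
    case True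
    then obtain a' b' r' where "(a', b', r') \<in> R" "L = cds (a' @ [r'])" "M = []"
      unfolding erasures_def by blast
    then show ?thesis using that[of "a' @ [r']"] names_fresh[OF assms(2)] by auto
  next
    case False
    then obtain a' b' r' where "(a', b', r') \<in> R" "L = cds a'"
      using LM unfolding replacements_def by blast
    then show ?thesis using that[of a'] names_fresh[OF assms(2)] lhs_nonempty by blast
  qed
  have mono: "st_step (erasures \<union> replacements) (p @ L @ q) (p @ M @ q)" for p q
    using LM by (rule st_stepI)
  from cds_occurrences[OF eq[unfolded ls] ls(2)] consider
    N where "A = P @ cds ls @ N" "Q = N @ cd r @ C" | N where "C = N @ cds ls @ Q" "P = A @ cd r @ N"
    | l1 l2 where "ls = l1 @ r # l2" "A = P @ cds l1" "C = cds l2 @ Q" by blast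
  then show ?case
  proof cases
    case 1
    then have "W = (P @ M @ N) @ cd r @ C" using W by simp
    from step.hyps(3)[OF this] obtain y z where "rep_step\<^sup>*\<^sup>* (P @ M @ N) (y @ cds a)"
      "rep_step\<^sup>*\<^sup>* C z" "rep_step\<^sup>*\<^sup>* (y @ z) F" by blast
    moreover have "rep_step A (P @ M @ N)" using 1 mono[of P N] ls by simp
    ultimately show ?thesis by (meson converse_rtranclp_into_rtranclp)
  next
    case 2
    then have "W = A @ cd r @ (N @ M @ Q)" using W by simp
    from step.hyps(3)[OF this] obtain y z where "rep_step\<^sup>*\<^sup>* A (y @ cds a)"
      "rep_step\<^sup>*\<^sup>* (N @ M @ Q) z" "rep_step\<^sup>*\<^sup>* (y @ z) F" by blast
    moreover have "rep_step C (N @ M @ Q)" using 2 mono[of N Q] ls by simp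
    ultimately show ?thesis by (meson converse_rtranclp_into_rtranclp)
  next
    case 3
    then obtain a' b' where ab: "(a', b', r) \<in> R" "ls = a' @ [r]" "r \<notin> set a'" "M = []" using lsr by auto
    have "a' = a" using names_det ab(1) assms(2) by blast
    \<comment> \<open>Within the erased block \<open>r\<close> occurs only at the end. Hence the
      word before the name ends with the code of \<open>a\<close>, and \<open>P\<close> and
      \<open>C\<close> serve as \<open>y\<close> and \<open>z\<close>.\<close>
    have "l1 = a' \<and> l2 = []" using 3(1) ab(2,3) by (cases l2 rule: rev_cases) auto
    then have "A = P @ cds a" "C = Q" "W = P @ Q" using 3 W ab \<open>a' = a\<close> by auto
    with step.hyps(2) show ?thesis by blast
  qed
qed

text \<open>Induction from the front, so the derivation after the first step is already free of
  insertions. An inserted name separates it into a left part ending in \<open>a\<close> and a right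
  part starting from \<open>b\<close>. Running the left part first, replacing \<open>a\<close> by
  \<open>b\<close> and then running the right part gives the same result without the
  insertion.\<close>

lemma insertions_eliminable:
  assumes "ins_step\<^sup>*\<^sup>* W F" "name_free F"
  shows "rep_step\<^sup>*\<^sup>* W F"
  using assms(1)
proof (induction rule: converse_rtranclp_induct)
  case (step W W')
  from step.hyps(1) obtain L M P Q where LM: "(L, M) \<in> erasures \<union> insertions"
    and W: "W = P @ L @ Q" "W' = P @ M @ Q"
    unfolding st_step_def by blast
  show ?case
  proof (cases "(L, M) \<in> erasures")
    case True
    then have "rep_step W W'" unfolding W by (intro st_stepI) blast
    with step.IH show ?thesis by (meson converse_rtranclp_into_rtranclp)
  next
    case False
    then obtain a b r where R: "(a, b, r) \<in> R" and L: "L = []" and M: "M = cds (r # b)"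
      using LM unfolding insertions_def by auto
    have "rep_step\<^sup>*\<^sup>* (P @ cd r @ (cds b @ Q)) F" using step.IH W M by simp
    from name_consumed[OF this R assms(2)] obtain y z where
      yz: "rep_step\<^sup>*\<^sup>* P (y @ cds a)" "rep_step\<^sup>*\<^sup>* (cds b @ Q) z" "rep_step\<^sup>*\<^sup>* (y @ z) F" by blast
    have "rep_step\<^sup>*\<^sup>* W (y @ cds a @ Q)" using st_steps_context[OF yz(1), of "[]" Q] W L by simp
    also have "rep_step (y @ cds a @ Q) (y @ cds b @ Q)"
      by (rule st_stepI) (use R in \<open>auto simp: replacements_def\<close>)
    also have "rep_step\<^sup>*\<^sup>* (y @ cds b @ Q) (y @ z)" using st_steps_context[OF yz(2), of y "[]"] by simp
    also note yz(3)
    finally show ?thesis .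
  qed
qed simp

text \<open>Names never appear, since no rule side contains one. So no erasure can fire, and by
  alignment every replacement acts on whole letters.\<close>

lemma rep_steps_decode:
  assumes "rep_step\<^sup>*\<^sup>* (cds x @ [False]) F" "\<And>a b r. (a, b, r) \<in> R \<Longrightarrow> r \<notin> set x"
  shows "\<exists>y. F = cds y @ [False] \<and> (st_step plain_rules)\<^sup>*\<^sup>* x y \<and> (\<forall>a b r. (a, b, r) \<in> R \<longrightarrow> r \<notin> set y)"
  using assms(1)
proof (induction)
  case base
  then show ?case using assms(2) by blast
next
  case (step F F')
  then obtain y where y: "F = cds y @ [False]" "(st_step plain_rules)\<^sup>*\<^sup>* x y"
    "\<And>a b r. (a, b, r) \<in> R \<Longrightarrow> r \<notin> set y" by blast
  from step.hyps(2) obtain L M P Q where LM: "(L, M) \<in> erasures \<union> replacements"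
    and F: "F = P @ L @ Q" "F' = P @ M @ Q"
    unfolding st_step_def by blast
  show ?case
  proof (cases "(L, M) \<in> erasures")
    case True
    then obtain a b r where R: "(a, b, r) \<in> R" "L = cds (a @ [r])" unfolding erasures_def by blast
    have "cds y @ [False] = P @ cds (a @ [r]) @ Q" using F y R by simp
    from cds_aligned[OF this] have "r \<in> set y" by auto
    with y(3) R show ?thesis by blast
  next
    case False
    then obtain a b r where R: "(a, b, r) \<in> R" "L = cds a" "M = cds b"
      using LM unfolding replacements_def by blast
    have "cds y @ [False] = P @ cds a @ Q" using F y R by simp
    from cds_aligned[OF this lhs_nonempty[OF R(1)]] obtain x1 x2 where
      x: "y = x1 @ a @ x2" "P = cds x1" "Q = cds x2 @ [False]" by blast
    have "F' = cds (x1 @ b @ x2) @ [False]" using F R x by simp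
    moreover have "st_step plain_rules y (x1 @ b @ x2)" unfolding x(1)
      by (rule st_stepI) (use R in auto)
    moreover have "\<forall>a' b' r. (a', b', r) \<in> R \<longrightarrow> r \<notin> set (x1 @ b @ x2)"
      using y(3) x(1) names_fresh R(1) by fastforce
    ultimately show ?thesis using rtranclp.rtrancl_into_rtrancl[OF y(2)] by blast
  qed
qed

theorem ins_steps_sound:
  assumes "ins_step\<^sup>*\<^sup>* (cds x @ [False]) (cds y @ [False])"
    and "\<And>a b r. (a, b, r) \<in> R \<Longrightarrow> r \<notin> set x" "\<And>a b r. (a, b, r) \<in> R \<Longrightarrow> r \<notin> set y"
  shows "(st_step plain_rules)\<^sup>*\<^sup>* x y"
proof -
  have "name_free (cds y @ [False])" unfolding name_free_def
  proof (intro allI impI notI)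
    fix a b r P Q assume "(a, b, r) \<in> R" "cds y @ [False] = P @ cd r @ Q"
    then show False using cds_aligned[of y P "[r]" Q] assms(3) by fastforce
  qed
  from insertions_eliminable[OF assms(1) this] obtain y' where
    "cds y @ [False] = cds y' @ [False]" "(st_step plain_rules)\<^sup>*\<^sup>* x y'"
    using rep_steps_decode assms(2) by blast
  then show ?thesis using cds_end_inj by blast
qed

end

section \<open>Bits as the nonterminals A and B, and their weight\<close>

definition bits :: "bool list \<Rightarrow> 't sym list" where
  "bits = map (\<lambda>b. Nt (if b then 0 else 1))"

lemma bits_simps [simp]: "bits [] = []" "bits (b # x) = Nt (if b then 0 else 1) # bits x"
  "bits (x @ y) = bits x @ bits y" "bits (rev x) = rev (bits x)"
  by (simp_all add: bits_def rev_map)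

lemma bits_eq_Nil [simp]: "bits x = [] \<longleftrightarrow> x = []" "[] = bits x \<longleftrightarrow> x = []"
  by (auto simp: bits_def)

lemma set_bits: "set (bits x) \<subseteq> {Nt 0, Nt 1}" by (auto simp: bits_def)

text \<open>The surplus of A over B. Code words are balanced, so only the extra B of a start push
  changes it.\<close>

definition wt :: "'t sym list \<Rightarrow> int" where
  "wt z = int (count_list z (Nt 0)) - int (count_list z (Nt 1))"

lemma wt_simps [simp]: "wt [] = 0" "wt (x @ y) = wt x + wt y" "wt (rev x) = wt x"
  "wt (s # x) = (if s = Nt 0 then 1 else if s = Nt 1 then -1 else 0) + wt x"
  by (simp_all add: wt_def)

lemma wt_map_Tm [simp]: "wt (map Tm w) = 0" by (induction w) auto

lemma wt_cd [simp]: "wt (bits (cd i)) = 0"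
proof -
  have "wt (bits (concat (replicate n [True, False]))) = 0" for n by (induction n) auto
  then show ?thesis by (simp add: cd_def)
qed

lemma wt_cds [simp]: "wt (bits (cds xs)) = 0" by (induction xs) auto

section \<open>The grammar with five nonterminals\<close>

text \<open>\<open>e\<close> numbers symbols and \<open>rc\<close> names rules, with disjoint values
  so that names are fresh. The identity rules added in \<open>RR\<close> do not change the language,
  but let the head move past a symbol.\<close>

locale psg_coding =
  fixes G :: "'t psg" and RR :: "('t sym list \<times> 't sym list) set"
    and e :: "'t sym \<Rightarrow> nat" and rc :: "'t sym list \<times> 't sym list \<Rightarrow> nat"
  assumes wf: "psg_wf G"
    and RR_def: "RR = gR G \<union> (\<lambda>s. ([s], [s])) ` psg_V G"
    and e_inj: "inj_on e (psg_V G)" and rc_inj: "inj_on rc RR"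
    and e_rc: "s \<in> psg_V G \<Longrightarrow> \<rho> \<in> RR \<Longrightarrow> e s \<noteq> rc \<rho>"
begin

abbreviation "V\<^sub>G \<equiv> psg_V G"

definition R where "R = {(map e a, map e b, rc (a, b)) | a b. (a, b) \<in> RR}"

lemma R_mem: "(a, b) \<in> RR \<Longrightarrow> (map e a, map e b, rc (a, b)) \<in> R"
  unfolding R_def by blast

lemma RR_props: "(a, b) \<in> RR \<Longrightarrow> a \<noteq> [] \<and> set a \<subseteq> V\<^sub>G \<and> set b \<subseteq> V\<^sub>G"
  using wf unfolding RR_def psg_wf_def by fastforce

sublocale coded_rules R
proof
  fix a b r assume "(a, b, r) \<in> R"
  then show "a \<noteq> []" using RR_props by (auto simp: R_def)
next
  fix a b r a' b' r' assume "(a, b, r) \<in> R" "(a', b', r') \<in> R"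
  then show "r \<notin> set a' \<and> r \<notin> set b'" using RR_props e_rc unfolding R_def by fastforce
next
  fix a b r a' b' assume "(a, b, r) \<in> R" "(a', b', r) \<in> R"
  then show "a = a' \<and> b = b'" using rc_inj unfolding R_def inj_on_def by auto
qed

definition enc :: "'t sym list \<Rightarrow> bool list" where "enc x = cds (map e x)"

lemma enc_simps [simp]: "enc [] = []" "enc (x @ y) = enc x @ enc y" "enc (s # x) = cd (e s) @ enc x"
  by (simp_all add: enc_def)

lemma plain_steps_decode:
  assumes "(st_step plain_rules)\<^sup>*\<^sup>* (map e x) y" "set x \<subseteq> V\<^sub>G"
  shows "\<exists>x'. y = map e x' \<and> set x' \<subseteq> V\<^sub>G \<and> (psg_step G)\<^sup>*\<^sup>* x x'"
  using assms(1)
proof induction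
  case base
  then show ?case using assms(2) by blast
next
  case (step y z)
  then obtain x' where x': "y = map e x'" "set x' \<subseteq> V\<^sub>G" "(psg_step G)\<^sup>*\<^sup>* x x'" by blast
  from step.hyps(2) obtain a b u v where ab: "(a, b) \<in> RR"
    and y: "y = u @ map e a @ v" and z: "z = u @ map e b @ v"
    unfolding st_step_def R_def by auto
  have "map e x' = u @ (map e a @ v)" using x'(1) y by simp
  from iffD1[OF map_eq_append_conv this] obtain u' k where
    k: "x' = u' @ k" "u = map e u'" "map e a @ v = map e k" by blast
  from iffD1[OF map_eq_append_conv k(3)[symmetric]] obtain a' v' where
    "k = a' @ v'" "map e a = map e a'" "v = map e v'" by blast
  with k have s: "x' = u' @ a' @ v'" "u = map e u'" "map e a = map e a'" "v = map e v'" by simp_all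
  have "a = a'" using s(3) by (rule map_inj_on)
      (use x'(2) s(1) RR_props[OF ab] in \<open>auto intro: inj_on_subset[OF e_inj]\<close>)
  have "z = map e (u' @ b @ v')" using z s by simp
  moreover have "set (u' @ b @ v') \<subseteq> V\<^sub>G" using x'(2) s(1) RR_props[OF ab] by auto
  \<comment> \<open>An added identity rule leaves the word as it is, hence the second
    alternative.\<close>
  moreover have "psg_step G x' (u' @ b @ v') \<or> x' = u' @ b @ v'"
    using ab s(1) \<open>a = a'\<close> unfolding RR_def psg_step_def by auto
  ultimately show ?case using x'(3) by (metis rtranclp.rtrancl_into_rtrancl)
qed

lemma gS_V: "Nt (gS G) \<in> V\<^sub>G" using wf by (auto simp: psg_wf_def psg_V_def)

lemma ins_steps_lang:
  assumes "ins_step\<^sup>*\<^sup>* (enc [Nt (gS G)] @ [False]) (enc (map Tm w) @ [False])" "set w \<subseteq> gT G"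
  shows "w \<in> psg_lang G"
proof -
  have w: "set (map Tm w) \<subseteq> V\<^sub>G" using assms(2) by (auto simp: psg_V_def)
  have fresh: "r \<notin> set (map e x)" if "(a, b, r) \<in> R" "set x \<subseteq> V\<^sub>G" for a b r x
    using that e_rc unfolding R_def by fastforce
  have "(st_step plain_rules)\<^sup>*\<^sup>* (map e [Nt (gS G)]) (map e (map Tm w))"
    using assms(1) unfolding enc_def
    by (rule ins_steps_sound) (use fresh[of _ _ _ "[Nt (gS G)]"] fresh[OF _ w] gS_V in auto)
  from plain_steps_decode[OF this] gS_V obtain x' where
    x': "map e (map Tm w) = map e x'" "set x' \<subseteq> V\<^sub>G" "(psg_step G)\<^sup>*\<^sup>* [Nt (gS G)] x'" by auto
  from x'(1) have "map Tm w = x'"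
    by (rule map_inj_on) (use x'(2) w in \<open>auto intro: inj_on_subset[OF e_inj]\<close>)
  with x'(3) assms(2) show ?thesis by (simp add: psg_lang_def)
qed

text \<open>The left stack is read from the head outwards, hence the reversal; w1 has been output already
  and w2 is still to be output. No push raises the weight difference, so once below -1 the stacks
  can never be emptied.\<close>

definition Sem :: "'t sym list \<Rightarrow> bool list \<Rightarrow> bool" where
  "Sem U V \<longleftrightarrow> (\<forall>w1 X w2. U = map Tm w1 @ bits (rev X) \<longrightarrow> ins_step\<^sup>*\<^sup>* V (X @ enc (map Tm w2) @ [False])
     \<longrightarrow> ins_step\<^sup>*\<^sup>* (enc [Nt (gS G)] @ [False]) (enc (map Tm (w1 @ w2)) @ [False]))"

text \<open>Pops keep the weight difference and a start push lowers it by one. The three cases thus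
  stand for no start push, at least two, and exactly one.\<close>

definition Adm :: "'t sym list \<Rightarrow> bool list \<Rightarrow> bool" where
  "Adm U V \<longleftrightarrow> (U = [] \<and> V = []) \<or> wt (bits V :: 't sym list) - wt U \<le> -2 \<or> (wt (bits V :: 't sym list) - wt U = -1 \<and> Sem U V)"

text \<open>A pair (l, r) is put to the left and to the right of the head. The three kinds insert
  \<open>r b\<close>, prepare the cancellation of \<open>a r\<close>, and output a terminal together
  with the mirrored code that cancels its code on the right.\<close>

definition push :: "('t sym list \<times> bool list) set" where
  "push = (\<lambda>(a, b). ([], cds (rc (a, b) # map e b))) ` RR
     \<union> (\<lambda>(a, b). (bits (rev (cds (map e a @ [rc (a, b)]))), [])) ` RR
     \<union> (\<lambda>t. (Tm t # bits (rev (cd (e (Tm t)))), [])) ` gT G"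

text \<open>From empty stacks, \<open>Sem\<close> holds since its premise is its conclusion; from
  any other state the difference drops to -2 or below.\<close>

lemma Adm_start: "Adm U V \<Longrightarrow> Adm U (enc [Nt (gS G)] @ [False] @ V)"
  by (auto simp: Adm_def Sem_def)

lemma Sem_ins:
  assumes "Sem U V" "(a, b) \<in> RR" shows "Sem U (cds (rc (a, b) # map e b) @ V)"
proof -
  have "ins_step ([] @ [] @ V) ([] @ cds (rc (a, b) # map e b) @ V)"
    using insertionsI[OF R_mem[OF assms(2)]] by (intro st_stepI) blast
  then have "ins_step\<^sup>*\<^sup>* V z" if "ins_step\<^sup>*\<^sup>* (cds (rc (a, b) # map e b) @ V) z" for z
    using that by (auto intro: converse_rtranclp_into_rtranclp)
  then show ?thesis using assms(1) unfolding Sem_def by blast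
qed

lemma Tm_bits_split:
  assumes "U @ bits Y = map Tm w @ bits X"
  shows "\<exists>X0. U = map Tm w @ bits X0 \<and> X = X0 @ Y"
  using assms
proof (induction Y arbitrary: X rule: rev_induct)
  case (snoc y Y)
  show ?case
  proof (cases X rule: rev_cases)
    case Nil
    have "Nt (if y then 0 else 1) \<in> set (U @ bits (Y @ [y]))" by simp
    then show ?thesis unfolding snoc.prems Nil by auto
  next
    case (snoc X' x)
    then have "U @ bits Y = map Tm w @ bits X'" "x = y" using snoc.prems by (auto split: if_splits)
    then show ?thesis using snoc.IH snoc by auto
  qed
qed auto

text \<open>The mirrored code ends the left stack, so \<open>X\<close> begins with the code of
  \<open>a r\<close>; one erasure removes it and the old \<open>Sem\<close> applies.\<close>

lemma Sem_del:
  assumes "Sem U V" "(a, b) \<in> RR" shows "Sem (U @ bits (rev (cds (map e a @ [rc (a, b)])))) V"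
  unfolding Sem_def
proof (intro allI impI)
  fix w1 X w2
  let ?d = "cds (map e a @ [rc (a, b)])"
  assume U: "U @ bits (rev ?d) = map Tm w1 @ bits (rev X)"
    and V: "ins_step\<^sup>*\<^sup>* V (X @ enc (map Tm w2) @ [False])"
  from Tm_bits_split[OF U] obtain X0 where X0: "U = map Tm w1 @ bits X0" "rev X = X0 @ rev ?d" by blast
  have X: "X = ?d @ rev X0" using X0(2) by (metis rev_append rev_rev_ident)
  have "ins_step ([] @ ?d @ rev X0 @ enc (map Tm w2) @ [False]) ([] @ [] @ rev X0 @ enc (map Tm w2) @ [False])"
    using erasuresI[OF R_mem[OF assms(2)]] by (intro st_stepI) blast
  then have "ins_step\<^sup>*\<^sup>* V (rev X0 @ enc (map Tm w2) @ [False])" using V X by simp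
  moreover have "U = map Tm w1 @ bits (rev (rev X0))" using X0 by simp
  ultimately show "ins_step\<^sup>*\<^sup>* (enc [Nt (gS G)] @ [False]) (enc (map Tm (w1 @ w2)) @ [False])"
    using assms(1) unfolding Sem_def by blast
qed

text \<open>Only the code of \<open>t\<close> follows the new terminal, so \<open>X\<close> is
  exactly this code. The claim is the old \<open>Sem\<close> with \<open>t\<close> moved from the
  end of \<open>w1\<close> to the front of \<open>w2\<close>.\<close>

lemma Sem_emit:
  assumes "Sem U V" shows "Sem (U @ Tm t # bits (rev (cd (e (Tm t))))) V"
  unfolding Sem_def
proof (intro allI impI)
  fix w1 X w2
  let ?d = "cd (e (Tm t))"
  assume U: "U @ Tm t # bits (rev ?d) = map Tm w1 @ bits (rev X)"
    and V: "ins_step\<^sup>*\<^sup>* V (X @ enc (map Tm w2) @ [False])"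
  have "(U @ [Tm t]) @ bits (rev ?d) = map Tm w1 @ bits (rev X)" using U by simp
  from Tm_bits_split[OF this] obtain X0 where X0: "U @ [Tm t] = map Tm w1 @ bits X0" "rev X = X0 @ rev ?d" by blast
  have "X0 = []" using X0(1) by (cases X0 rule: rev_cases) auto
  then obtain w0 where w0: "w1 = w0 @ [t]" "U = map Tm w0 @ bits (rev [])" "X = ?d" using X0
    by (cases w1 rule: rev_cases) auto
  have "ins_step\<^sup>*\<^sup>* V ([] @ enc (map Tm (t # w2)) @ [False])" using V w0 by simp
  then have "ins_step\<^sup>*\<^sup>* (enc [Nt (gS G)] @ [False]) (enc (map Tm (w0 @ t # w2)) @ [False])"
    using assms w0(2) unfolding Sem_def by blast
  then show "ins_step\<^sup>*\<^sup>* (enc [Nt (gS G)] @ [False]) (enc (map Tm (w1 @ w2)) @ [False])"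
    using w0 by simp
qed

lemma Adm_push:
  assumes "(l, r) \<in> push" "Adm U V" "U \<noteq> [] \<or> V \<noteq> []" shows "Adm (U @ l) (r @ V)"
proof -
  have "wt l = 0" "wt (bits r :: 't sym list) = 0" using assms(1) by (auto simp: push_def)
  moreover have "Sem (U @ l) (r @ V)" if "Sem U V"
    using assms(1) Sem_ins[OF that] Sem_del[OF that] Sem_emit[OF that] by (auto simp: push_def)
  ultimately show ?thesis using assms(2,3) by (auto simp: Adm_def)
qed

text \<open>A derivation from \<open>V\<close> remains one after the bit \<open>b\<close> is put in
  front, and removing equal bits keeps the weight difference.\<close>

lemma Adm_pop:
  assumes "Adm (U @ bits [b]) (b # V)" shows "Adm U V"
proof -
  have "Sem U V" if S: "Sem (U @ bits [b]) (b # V)"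
    unfolding Sem_def
  proof (intro allI impI)
    fix w1 X w2
    assume "U = map Tm w1 @ bits (rev X)" and V: "ins_step\<^sup>*\<^sup>* V (X @ enc (map Tm w2) @ [False])"
    then have "U @ bits [b] = map Tm w1 @ bits (rev (b # X))" by simp
    moreover have "ins_step\<^sup>*\<^sup>* (b # V) ((b # X) @ enc (map Tm w2) @ [False])"
      using st_steps_context[OF V, of "[b]" "[]"] by simp
    ultimately show "ins_step\<^sup>*\<^sup>* (enc [Nt (gS G)] @ [False]) (enc (map Tm (w1 @ w2)) @ [False])"
      using S unfolding Sem_def by blast
  qed
  then show ?thesis using assms by (auto simp: Adm_def)
qed

text \<open>The erased B is the only bit. On the left stack it would make the difference +1, which
  is not admissible. So it is the right stack, and the left stack is the terminal word.\<close>

lemma Adm_final: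
  assumes "Adm U V" "U @ bits V = p @ [Nt 1] @ q" "p @ q = map Tm w" "set w \<subseteq> gT G"
  shows "w \<in> psg_lang G"
proof (cases V rule: rev_cases)
  case Nil
  have "wt U = wt (p @ q) - 1" using assms(2) Nil by simp
  then have "wt U = -1" using assms(3) by simp
  then show ?thesis using assms(1) Nil by (auto simp: Adm_def)
next
  case (snoc V' b)
  have q: "q = []"
  proof (cases q rule: rev_cases)
    case (snoc q' x)
    then have "x = Nt (if b then 0 else 1)" using assms(2) \<open>V = V' @ [b]\<close> by simp
    moreover have "x \<in> set (map Tm w)" unfolding assms(3)[symmetric] snoc by simp
    ultimately show ?thesis by auto
  qed
  then have b: "b = False" "U @ bits V' = map Tm w" using assms(2,3) snoc by (auto split: if_splits)
  have "V' = []" using b(2) by (cases V') (auto simp: append_eq_map_conv Cons_eq_map_conv)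
  then have U: "U = map Tm w" "V = [False]" using b snoc by auto
  then have "Sem U V" using assms(1) by (auto simp: Adm_def)
  \<comment> \<open>The instance of \<open>Sem\<close> with empty \<open>X\<close> and
    \<open>w2\<close>, reached by the empty derivation.\<close>
  then have "ins_step\<^sup>*\<^sup>* (enc [Nt (gS G)] @ [False]) (enc (map Tm w) @ [False])"
    using U unfolding Sem_def by (metis append_Nil append_Nil2 bits_simps(1) enc_simps(1) list.simps(8) rev.simps(1) rtranclp.rtrancl_refl)
  then show ?thesis using assms(4) by (rule ins_steps_lang)
qed

end

lemma count_list_0: "s \<notin> set x \<Longrightarrow> count_list x s = 0"
  by (simp add: count_list_0_iff)

lemma rewrite_seq2I:
  assumes "x = u @ Nt A # v" "u @ w @ v = u' @ Nt B # v'" "y = u' @ w' @ v'"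
  shows "rewrite_seq [(A, w), (B, w')] x y"
  using assms by auto

lemma rewrite_seq2E:
  assumes "rewrite_seq [(A, w), (B, w')] x y"
  obtains u v u' v' where "x = u @ Nt A # v" "u @ w @ v = u' @ Nt B # v'" "y = u' @ w' @ v'"
  using assms by auto

abbreviation "CL \<equiv> range Tm \<union> {Nt 0, Nt 1}"

text \<open>Relates a symbol \<open>s0\<close> before marking to \<open>s\<close> after it. Which
  occurrences of the bit \<open>k\<close> are marked is left open; the numbers of X and Y are fixed
  separately by counting.\<close>

definition mk :: "nat \<Rightarrow> 't sym \<Rightarrow> 't sym \<Rightarrow> bool" where
  "mk k s0 s \<longleftrightarrow> s = s0 \<or> (s0 = Nt k \<and> (s = Nt 2 \<or> s = Nt 3))"

lemma mk_refl: "list_all2 (mk k) x x"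
  by (simp add: list_all2_refl mk_def)

lemma mk_unmarked: "list_all2 (mk k) x y \<Longrightarrow> Nt 2 \<notin> set y \<Longrightarrow> Nt 3 \<notin> set y \<Longrightarrow> x = y"
  by (induction rule: list_all2_induct) (auto simp: mk_def)

lemma mk_split:
  assumes "list_all2 (mk k) z0 (u @ s # v)"
  obtains u0 s0 v0 where "z0 = u0 @ s0 # v0" "list_all2 (mk k) u0 u" "mk k s0 s" "list_all2 (mk k) v0 v"
  using assms by (auto simp: list_all2_append2 list_all2_Cons2)

lemma mk_change:
  assumes "list_all2 (mk k) z0 (u @ s # v)" "\<And>s0. mk k s0 s \<Longrightarrow> mk k s0 s'"
  shows "list_all2 (mk k) z0 (u @ s' # v)"
  using assms(1) by (rule mk_split) (auto intro!: list_all2_appendI assms(2))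

context psg_coding
begin

text \<open>The rule B -> B forces the start matrix to be applied first.\<close>

definition pushm :: "'t sym list \<times> bool list \<Rightarrow> 't matrix" where
  "pushm = (\<lambda>(l, r). ([(1, [Nt 1]), (4, l @ [Nt 4] @ bits r)], None, None))"

definition startm :: "'t matrix" where
  "startm = ([(4, [Nt 4] @ bits (enc [Nt (gS G)] @ [False]))], None, None)"

definition finm :: "'t matrix" where
  "finm = ([(1, []), (4, [])], None, None)"

definition markm :: "nat \<Rightarrow> 't matrix" where
  "markm k = ([(k, [Nt 2]), (k, [Nt 3])], None, None)"

definition popm :: "'t matrix" where
  "popm = ([(2, []), (4, [])], Some [Nt 2, Nt 4, Nt 3], None)"

definition backm :: "'t matrix" where
  "backm = ([(3, [Nt 4])], None, Some [Nt 2])"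

definition M :: "'t scm" where
  "M = \<lparr>sT = gT G, sN = {0, 1, 2, 3, 4}, sS = 4,
        sM = pushm ` push \<union> {startm, finm, markm 0, markm 1, popm, backm}\<rparr>"

lemma finite_RR: "finite RR"
  using wf unfolding RR_def psg_wf_def psg_V_def by auto

lemma push_CL: "(l, r) \<in> push \<Longrightarrow> set l \<subseteq> Tm ` gT G \<union> {Nt 0, Nt 1}"
  using set_bits by (fastforce simp: push_def)

lemma M_in_SSCM: "in_SSCM 3 1 5 2 2 M"
proof -
  have V: "scm_V M = Tm ` gT G \<union> {Nt 0, Nt 1, Nt 2, Nt 3, Nt 4}"
    by (auto simp: scm_V_def M_def)
  have N: "sN M = {0, 1, 2, 3, 4}" by (simp add: M_def)
  have b: "set (bits x :: 't sym list) \<subseteq> scm_V M" for x using set_bits[of x] unfolding V by blast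
  have fin: "finite (sM M)" using finite_RR wf by (auto simp: M_def push_def psg_wf_def)
  have conds: "rs \<noteq> [] \<and> (\<forall>(A, w) \<in> set rs. A \<in> sN M \<and> set w \<subseteq> scm_V M)
      \<and> (\<forall>p. P = Some p \<longrightarrow> p \<noteq> [] \<and> set p \<subseteq> scm_V M) \<and> (\<forall>f. F = Some f \<longrightarrow> f \<noteq> [] \<and> set f \<subseteq> scm_V M)
      \<and> olen P \<le> 3 \<and> olen F \<le> 1 \<and> length rs \<le> 2 \<and> (P = None \<or> F = None)"
    if m: "(rs, P, F) \<in> sM M" for rs P F
  proof (cases "(rs, P, F) \<in> pushm ` push")
    case True
    then obtain l r where "(l, r) \<in> push" "(rs, P, F) = pushm (l, r)" by auto
    with push_CL[of l r] b[of r] show ?thesis unfolding N V by (auto simp: pushm_def olen_def)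
  next
    case False
    then have "(rs, P, F) \<in> {startm, finm, markm 0, markm 1, popm, backm}" using m by (simp add: M_def)
    then show ?thesis using b[of "enc [Nt (gS G)]"] unfolding N V
      by (auto simp: startm_def finm_def markm_def popm_def backm_def olen_def)
  qed
  have "finite (sT M)" "finite (sN M)" "sS M \<in> sN M" using wf by (auto simp: psg_wf_def M_def)
  then have wf': "scm_wf M" unfolding scm_wf_def using fin conds by blast
  have "{r \<in> sM M. conditional r} \<subseteq> {popm, backm}"
    by (auto simp: M_def conditional_def pushm_def startm_def finm_def markm_def)
  then have "card {r \<in> sM M. conditional r} \<le> card {popm, backm}" by (intro card_mono) auto
  also have "\<dots> \<le> 2" by (simp add: card_insert_if)
  finally have c: "card {r \<in> sM M. conditional r} \<le> 2" .
  have "{r \<in> sM M. nonsimple r} = {}" using conds by (force simp: nonsimple_def)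
  then have ns: "card {r \<in> sM M. nonsimple r} \<le> 0" by (metis card.empty order_refl)
  have "card (sN M) \<le> 5" by (simp add: M_def)
  then show ?thesis unfolding in_SSCM_def in_SCM_def using wf' c ns conds by auto
qed

section \<open>Soundness: the invariant of the matrix grammar\<close>

lemma Adm_push_any:
  assumes "(l, r) \<in> push \<and> (U \<noteq> [] \<or> V \<noteq> []) \<or> (l, r) = ([], enc [Nt (gS G)] @ [False])" "Adm U V"
  shows "Adm (U @ l) (r @ V)"
  using assms Adm_push Adm_start by auto

text \<open>The last case is never left, since every removal of an X also removes an S.\<close>

inductive good :: "'t sym list \<Rightarrow> bool" where
  clean: "set U \<subseteq> CL \<Longrightarrow> Adm U V \<Longrightarrow> good (U @ Nt 4 # bits V)"
| marked: "set U \<subseteq> CL \<Longrightarrow> Adm U V \<Longrightarrow> k < 2 \<Longrightarrow> list_all2 (mk k) (U @ Nt 4 # bits V) z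
    \<Longrightarrow> count_list z (Nt 2) = 1 \<Longrightarrow> count_list z (Nt 3) = 1 \<Longrightarrow> good z"
| hole: "set U \<subseteq> CL \<Longrightarrow> Adm U V \<Longrightarrow> good (U @ Nt 3 # bits V)"
| finished: "Nt 2 \<notin> set z \<Longrightarrow> Nt 3 \<notin> set z \<Longrightarrow> Nt 4 \<notin> set z
    \<Longrightarrow> (\<And>w. z = map Tm w \<Longrightarrow> set w \<subseteq> gT G \<Longrightarrow> w \<in> psg_lang G) \<Longrightarrow> good z"
| dead: "count_list z (Nt 2) > count_list z (Nt 4) \<Longrightarrow> good z"

lemma CL_bits_notin:
  fixes U :: "'t sym list"
  assumes "set U \<subseteq> CL" "i \<ge> 2" shows "Nt i \<notin> set U \<and> Nt i \<notin> set (bits V :: 't sym list)"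
  using assms set_bits[of V] by auto

lemma clean_split:
  fixes U :: "'t sym list"
  assumes "set U \<subseteq> CL" "i \<ge> 2" "U @ Nt i # bits V = u @ Nt i # v" shows "u = U" "v = bits V"
  using append_Cons_eq_iff[of "Nt i" U "bits V" u v] CL_bits_notin[OF assms(1,2), of V] assms(3) by auto

text \<open>A push is harmless even between marking and popping, because admissibility refers to the
  stacks before marking. A form with a hole has no S, so no push applies there.\<close>

lemma good_push:
  assumes "good (u @ Nt 4 # v)" 
    "(l, r) \<in> push \<and> (u \<noteq> [] \<or> v \<noteq> []) \<or> (l, r) = ([], enc [Nt (gS G)] @ [False])"
  shows "good (u @ l @ Nt 4 # bits r @ v)"
proof -
  have l: "set l \<subseteq> CL" using assms(2) push_CL by fastforce
  note lr = CL_bits_notin[OF l, of 2 r] CL_bits_notin[OF l, of 3 r] CL_bits_notin[OF l, of 4 r]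
  from assms(1) show ?thesis
  proof cases
    case (clean U V)
    then have uv: "u = U" "v = bits V" using clean_split[of U 4 V u v] by auto
    then have "Adm (U @ l) (r @ V)" using assms(2) uv clean by (intro Adm_push_any) auto
    then show ?thesis using good.clean[of "U @ l" "r @ V"] uv l clean by simp
  next
    case (marked U V k)
    from marked(4) obtain u0 s0 v0 where s: "U @ Nt 4 # bits V = u0 @ s0 # v0" "list_all2 (mk k) u0 u"
      "mk k s0 (Nt 4)" "list_all2 (mk k) v0 v" by (rule mk_split)
    then have "s0 = Nt 4" by (auto simp: mk_def)
    then have uv: "u0 = U" "v0 = bits V" using clean_split[OF marked(1), of 4 V u0 v0] s(1) by simp_all
    have "length u = length U" "length v = length V" 
      using list_all2_lengthD[OF s(2)] list_all2_lengthD[OF s(4)] uv by (auto simp: bits_def)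
    then have "Adm (U @ l) (r @ V)" using assms(2) marked by (intro Adm_push_any) auto
    moreover have "list_all2 (mk k) ((U @ l) @ Nt 4 # bits (r @ V)) (u @ l @ Nt 4 # bits r @ v)"
      using s uv mk_refl[of k l] mk_refl[of k "bits r"] by (auto intro!: list_all2_appendI simp: mk_def)
    ultimately show ?thesis using marked l lr
      by (intro good.marked[of "U @ l" "r @ V" k]) (auto simp: count_list_0)
  next
    case (hole U V)
    have "Nt 4 \<in> set (u @ Nt 4 # v)" by simp
    then show ?thesis unfolding hole(1) using CL_bits_notin[OF hole(2), of 4 V] by auto
  next
    case finished
    then show ?thesis by auto
  next
    case dead
    then show ?thesis using lr by (intro good.dead) (simp add: count_list_0)
  qed
qed

text \<open>From a clean form \<open>Adm_final\<close> applies. From a marked form the only S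
  disappears while an X stays, so the result is dead.\<close>

lemma good_fin:
  assumes "good z" "z = u @ Nt 1 # v" "u @ v = u' @ Nt 4 # v'"
  shows "good (u' @ v')"
  using assms(1)
proof cases
  case (clean U V)
  have cnt: "count_list z s = count_list (u' @ v') s + (if s = Nt 1 \<or> s = Nt 4 then 1 else 0)" for s
  proof -
    have "count_list z s = count_list (u @ v) s + (if s = Nt 1 then 1 else 0)" using assms(2) by auto
    then show ?thesis using assms(3) by auto
  qed
  have "count_list z (Nt 2) = 0 \<and> count_list z (Nt 3) = 0 \<and> count_list z (Nt 4) = 1"
    using CL_bits_notin[OF clean(2), of 2 V] CL_bits_notin[OF clean(2), of 3 V] CL_bits_notin[OF clean(2), of 4 V] clean by (simp add: count_list_0)
  then have "Nt 2 \<notin> set (u' @ v')" "Nt 3 \<notin> set (u' @ v')" "Nt 4 \<notin> set (u' @ v')"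
    using cnt[of "Nt 2"] cnt[of "Nt 3"] cnt[of "Nt 4"] by (auto simp: count_list_0_iff)
  then show ?thesis
  proof (rule good.finished)
    fix w assume w: "u' @ v' = map Tm w" "set w \<subseteq> gT G"
    from clean assms(2) have eq: "U @ Nt 4 # bits V = u @ Nt 1 # v" by simp
    show "w \<in> psg_lang G"
    \<comment> \<open>The erased B lies to the left or to the right of the head.\<close>
    proof (cases "length u < length U")
      case True
      then obtain k where k: "U = u @ k" "k @ Nt 4 # bits V = Nt 1 # v"
        using eq by (auto simp: append_eq_append_conv2)
      then obtain U2 where U: "U = u @ Nt 1 # U2" "v = U2 @ Nt 4 # bits V"
        using True by (cases k) auto
      have "(u @ U2) @ Nt 4 # bits V = u' @ Nt 4 # v'" using U assms(3) by simp
      then have "u' = u @ U2" "v' = bits V" using clean_split[of "u @ U2" 4 V u' v'] clean U by auto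
      then show ?thesis using Adm_final[OF clean(3), of u "U2 @ bits V" w] w U by simp
    next
      case False
      then obtain k where k: "u = U @ k" "Nt 4 # bits V = k @ Nt 1 # v"
        using eq by (auto simp: append_eq_append_conv2)
      then obtain k' where k': "k = Nt 4 # k'" "bits V = k' @ Nt 1 # v" by (cases k) auto
      have "U @ Nt 4 # (k' @ v) = u' @ Nt 4 # v'" using assms(3) k k' by simp
      moreover have "Nt 4 \<notin> set (k' @ v)" using CL_bits_notin[OF clean(2), of 4 V] k' by auto
      ultimately have "u' = U" "v' = k' @ v"
        using append_Cons_eq_iff[of "Nt 4" U "k' @ v" u' v'] CL_bits_notin[OF clean(2), of 4] by auto
      then show ?thesis using Adm_final[OF clean(3), of "U @ k'" v w] w k' by simp
    qed
  qed
next
  case (marked U V k)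
  have "count_list z (Nt 4) = 1"
  proof -
    have "list_all2 (mk k) x y \<Longrightarrow> count_list y (Nt 4) = count_list x (Nt 4)" for x y :: "'t sym list"
      by (induction rule: list_all2_induct) (use marked(3) in \<open>auto simp: mk_def\<close>)
    from this[OF marked(4)] show ?thesis using CL_bits_notin[OF marked(1), of 4 V] by (simp add: count_list_0)
  qed
  moreover have "count_list z (Nt 4) = Suc (count_list (u' @ v') (Nt 4))"
    "count_list z (Nt 2) = count_list (u' @ v') (Nt 2)"
    using assms(2) arg_cong[OF assms(3), of "\<lambda>x. count_list x (Nt 4)"]
      arg_cong[OF assms(3), of "\<lambda>x. count_list x (Nt 2)"] by auto
  ultimately have "count_list (u' @ v') (Nt 4) < count_list (u' @ v') (Nt 2)" using marked(5) by linarith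
  then show ?thesis by (rule good.dead)
next
  case (hole U V)
  have "Nt 4 \<in> set (u @ v)" unfolding assms(3) by simp
  then have "Nt 4 \<in> set z" using assms(2) by auto
  then show ?thesis unfolding hole(1) using CL_bits_notin[OF hole(2), of 4 V] by auto
next
  case finished
  have "Nt 4 \<in> set (u @ v)" unfolding assms(3) by simp
  then have "Nt 4 \<in> set z" using assms(2) by auto
  with finished show ?thesis by simp
next
  case dead
  then show ?thesis
    using assms(2) arg_cong[OF assms(3), of "\<lambda>x. count_list x (Nt 4)"]
      arg_cong[OF assms(3), of "\<lambda>x. count_list x (Nt 2)"] by (intro good.dead) auto
qed

text \<open>A clean form becomes marked. In every other form the additional X makes the number of X
  exceed that of S.\<close>

lemma good_mark:
  assumes "good z" "k < 2" "z = u @ Nt k # v" "u @ Nt 2 # v = u' @ Nt k # v'"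
  shows "good (u' @ Nt 3 # v')"
proof -
  have cnt: "count_list (u' @ Nt 3 # v') s = count_list z s + (if s = Nt 2 \<or> s = Nt 3 then 1 else 0)"
    if "s = Nt 2 \<or> s = Nt 3 \<or> s = Nt 4" for s
    using arg_cong[OF assms(4), of "\<lambda>x. count_list x s"] assms(2,3) that by auto
  from assms(1) show ?thesis
  proof cases
    case (clean U V)
    have eq: "U @ Nt 4 # bits V = u @ Nt k # v" using clean(1) assms(3) by simp
    have "list_all2 (mk k) (U @ Nt 4 # bits V) (u @ Nt k # v)" unfolding eq by (rule mk_refl)
    then have "list_all2 (mk k) (U @ Nt 4 # bits V) (u @ Nt 2 # v)"
      by (rule mk_change) (use assms(2) in \<open>auto simp: mk_def\<close>)
    then have "list_all2 (mk k) (U @ Nt 4 # bits V) (u' @ Nt 3 # v')"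
      unfolding assms(4) by (rule mk_change) (use assms(2) in \<open>auto simp: mk_def\<close>)
    moreover have "count_list z (Nt 2) = 0 \<and> count_list z (Nt 3) = 0"
      using CL_bits_notin[OF clean(2), of 2 V] CL_bits_notin[OF clean(2), of 3 V] CL_bits_notin[OF clean(2), of 4 V] clean by (simp add: count_list_0)
    ultimately show ?thesis
      using clean assms(2) cnt[of "Nt 2"] cnt[of "Nt 3"] by (intro good.marked[of U V k]) simp_all
  next
    case (marked U V j)
    have "list_all2 (mk j) x y \<Longrightarrow> count_list y (Nt 4) = count_list x (Nt 4)" for x y :: "'t sym list"
      by (induction rule: list_all2_induct) (use marked(3) in \<open>auto simp: mk_def\<close>)
    from this[OF marked(4)] have "count_list z (Nt 4) = 1"
      using CL_bits_notin[OF marked(1), of 4 V] by (simp add: count_list_0)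
    then show ?thesis using marked cnt[of "Nt 2"] cnt[of "Nt 4"] by (intro good.dead) simp
  next
    case (hole U V)
    have "count_list z (Nt 4) = 0"
      using CL_bits_notin[OF hole(2), of 4 V] hole by (simp add: count_list_0)
    then show ?thesis using cnt[of "Nt 2"] cnt[of "Nt 4"] by (intro good.dead) simp
  next
    case finished
    then show ?thesis using cnt[of "Nt 2"] cnt[of "Nt 4"] by (intro good.dead) (simp add: count_list_0)
  next
    case dead
    then show ?thesis using cnt[of "Nt 2"] cnt[of "Nt 4"] by (intro good.dead) simp
  qed
qed

text \<open>The factor XSY contains the only X, S and Y of a marked form. So the two bits next to
  the head were marked; both equal \<open>k\<close>, and cancelling them is a pop that leaves Y as
  the hole.\<close>

lemma good_pop:
  assumes "good z" "z = p @ [Nt 2, Nt 4, Nt 3] @ q" "z = u @ Nt 2 # v" "u @ v = u' @ Nt 4 # v'"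
  shows "good (u' @ v')"
  using assms(1)
proof cases
  case (clean U V)
  have "Nt 2 \<in> set z" using assms(2) by simp
  then show ?thesis unfolding clean(1) using CL_bits_notin[OF clean(2), of 2 V] by auto
next
  case (marked U V k)
  have "list_all2 (mk k) (U @ Nt 4 # bits V) ((p @ [Nt 2]) @ Nt 4 # (Nt 3 # q))" using marked(4) assms(2) by simp
  then obtain u0 s0 v0 where s: "U @ Nt 4 # bits V = u0 @ s0 # v0" "list_all2 (mk k) u0 (p @ [Nt 2])"
      "mk k s0 (Nt 4)" "list_all2 (mk k) v0 (Nt 3 # q)" by (rule mk_split)
  have "s0 = Nt 4" using s(3) by (auto simp: mk_def)
  then have uv: "u0 = U" "v0 = bits V" using clean_split[OF marked(1), of 4 V u0 v0] s(1) by simp_all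
  have pq: "Nt 2 \<notin> set (p @ q)" "Nt 3 \<notin> set (p @ q)"
    using marked(5,6) assms(2) by (auto simp: count_list_0_iff)
  from s(2) uv obtain p0 a where U: "U = p0 @ [a]" "list_all2 (mk k) p0 p" "mk k a (Nt 2)"
    by (auto simp: list_all2_append2 list_all2_Cons2)
  from s(4) uv obtain c q0 where V: "bits V = c # q0" "mk k c (Nt 3)" "list_all2 (mk k) q0 q"
    by (auto simp: list_all2_Cons2)
  have p: "p0 = p" "q0 = q" using mk_unmarked[OF U(2)] mk_unmarked[OF V(3)] pq by auto
  have "c \<in> set (bits V)" unfolding V(1) by simp
  then have "a \<in> CL" "c \<in> CL" using marked(1) U(1) set_bits[of V] by auto
  \<comment> \<open>Before marking these symbols were neither X nor Y, so both arose from the bit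
    \<open>k\<close>.\<close>
  then have ac: "a = Nt k" "c = Nt k" using U(3) V(2) by (auto simp: mk_def)
  obtain b V' where V': "V = b # V'" "Nt k = Nt (if b then 0 else 1)" "q = bits V'"
    using V(1) ac p by (cases V) auto
  have "Adm (p @ bits [b]) (b # V')" using marked(2) U(1) V' ac p by simp
  then have A: "Adm p V'" by (rule Adm_pop)
  have pCL: "set p \<subseteq> CL" using marked(1) U(1) p by auto
  have "p @ Nt 2 # (Nt 4 # Nt 3 # q) = u @ Nt 2 # v" using assms(2,3) by simp
  then have "u = p" "v = Nt 4 # Nt 3 # q"
    using append_Cons_eq_iff[of "Nt 2" p "Nt 4 # Nt 3 # q" u v] pq by auto
  then have "p @ Nt 4 # (Nt 3 # q) = u' @ Nt 4 # v'" using assms(4) by simp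
  then have "u' = p" "v' = Nt 3 # q"
    using append_Cons_eq_iff[of "Nt 4" p "Nt 3 # q" u' v'] CL_bits_notin[OF pCL, of 4 V'] V' by auto
  then show ?thesis using good.hole[OF pCL A] V' by simp
next
  case (hole U V)
  have "Nt 2 \<in> set z" using assms(2) by simp
  then show ?thesis unfolding hole(1) using CL_bits_notin[OF hole(2), of 2 V] by auto
next
  case finished
  then show ?thesis using assms(2) by simp
next
  case dead
  then show ?thesis
    using assms(3) arg_cong[OF assms(4), of "\<lambda>x. count_list x (Nt 4)"]
      arg_cong[OF assms(4), of "\<lambda>x. count_list x (Nt 2)"] by (intro good.dead) auto
qed

text \<open>Forbidding X excludes marked and dead forms, so Y can turn into S only in a
  hole.\<close>

lemma good_back:
  assumes "good z" "Nt 2 \<notin> set z" "z = u @ Nt 3 # v"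
  shows "good (u @ Nt 4 # v)"
  using assms(1)
proof cases
  case (clean U V)
  have "Nt 3 \<in> set z" using assms(3) by simp
  then show ?thesis unfolding clean(1) using CL_bits_notin[OF clean(2), of 3 V] by auto
next
  case marked
  then show ?thesis using assms(2) by (simp add: count_list_0)
next
  case (hole U V)
  then have "u = U" "v = bits V" using clean_split[of U 3 V u v] assms(3) by auto
  then show ?thesis using good.clean hole by simp
next
  case finished
  then show ?thesis using assms(3) by simp
next
  case dead
  then show ?thesis using assms(2) by (simp add: count_list_0)
qed

lemma good_step:
  assumes "good z" "scm_step M z y" shows "good y"
proof -
  from assms(2) obtain m where m: "m \<in> sM M" and st: "matrix_step m z y" unfolding scm_step_def by blast
  from m consider l r where "(l, r) \<in> push" "m = pushm (l, r)" | "m = startm" | "m = finm"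
    | "m = markm 0 \<or> m = markm 1" | "m = popm" | "m = backm"
    by (auto simp: M_def)
  then show ?thesis
  proof cases
    case 1
    have "rewrite_seq [(1, [Nt 1]), (4, l @ [Nt 4] @ bits r)] z y"
      using st 1 by (simp add: matrix_step_def pushm_def)
    then obtain u1 v1 u v where z1: "z = u1 @ Nt 1 # v1"
      and "u1 @ [Nt 1] @ v1 = u @ Nt 4 # v" "y = u @ (l @ [Nt 4] @ bits r) @ v"
      by (rule rewrite_seq2E)
    then have z: "z = u @ Nt 4 # v" "y = u @ l @ Nt 4 # bits r @ v" by simp_all
    \<comment> \<open>The rule B -> B guarantees a B besides the head, so the stacks are not both
      empty.\<close>
    have "Nt 1 \<in> set z" unfolding z1 by simp
    then have "u \<noteq> [] \<or> v \<noteq> []" using z by auto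
    then show ?thesis using good_push[of u v l r] assms(1) 1 z by simp
  next
    case 2
    from st 2 obtain u v where "z = u @ Nt 4 # v" "y = u @ [] @ Nt 4 # bits (enc [Nt (gS G)] @ [False]) @ v"
      by (auto simp: matrix_step_def startm_def)
    then show ?thesis using good_push[of u v "[]" "enc [Nt (gS G)] @ [False]"] assms(1) by simp
  next
    case 3
    with st show ?thesis using good_fin[OF assms(1)] by (auto simp: matrix_step_def finm_def)
  next
    case 4
    then obtain k :: nat where "k < 2" "m = markm k" using that[of 0] that[of 1] by auto
    with st show ?thesis using good_mark[OF assms(1)] by (auto simp: matrix_step_def markm_def)
  next
    case 5
    with st have "rewrite_seq [(2, []), (4, [])] z y" "sublist [Nt 2, Nt 4, Nt 3] z"
      by (simp_all add: matrix_step_def popm_def)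
    then obtain u v u' v' p q where "z = u @ Nt 2 # v" "u @ [] @ v = u' @ Nt 4 # v'" "y = u' @ [] @ v'"
      "z = p @ [Nt 2, Nt 4, Nt 3] @ q"
      by (elim rewrite_seq2E) (unfold sublist_def, blast)
    then show ?thesis using good_pop[OF assms(1), of p q u v u' v'] by simp
  next
    case 6
    with st show ?thesis using good_back[OF assms(1)]
      by (auto simp: matrix_step_def backm_def sublist_singleton)
  qed
qed

text \<open>A terminal word contains none of X, Y and S, so the invariant leaves only the case
  \<open>finished\<close>.\<close>

lemma scm_lang_M_subset: "scm_lang M \<subseteq> psg_lang G"
proof
  fix w assume "w \<in> scm_lang M"
  then have w: "set w \<subseteq> gT G" and d: "(scm_step M)\<^sup>*\<^sup>* [Nt 4] (map Tm w)"
    by (auto simp: scm_lang_def M_def)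
  from d have "good (map Tm w)"
  proof induction
    case base
    show ?case using good.clean[of "[]" "[]"] by (simp add: Adm_def)
  qed (rule good_step)
  then show "w \<in> psg_lang G"
  proof cases
    case (marked U V k)
    then show ?thesis by (simp add: count_list_0 image_iff)
  next
    case dead
    then show ?thesis by (simp add: count_list_0 image_iff)
  qed (use w in \<open>auto simp: map_eq_append_conv map_eq_Cons_conv Cons_eq_map_conv append_eq_map_conv\<close>)
qed

section \<open>Completeness: simulating a derivation and writing the output\<close>

lemma M_stepI: "m \<in> sM M \<Longrightarrow> matrix_step m x y \<Longrightarrow> scm_step M x y"
  unfolding scm_step_def by blast

lemma push_step:
  assumes "(l, r) \<in> push" "Nt 1 \<in> set (U @ Nt 4 # V)"
  shows "scm_step M (U @ Nt 4 # V) (U @ l @ Nt 4 # bits r @ V)"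
proof (rule M_stepI)
  show "pushm (l, r) \<in> sM M" using assms(1) by (simp add: M_def)
  obtain u v where "U @ Nt 4 # V = u @ Nt 1 # v" using assms(2) by (meson split_list)
  then have "rewrite_seq [(1, [Nt 1]), (4, l @ [Nt 4] @ bits r)] (U @ Nt 4 # V) (U @ l @ Nt 4 # bits r @ V)"
    by (intro rewrite_seq2I[of _ u _ v _ U _ V]) simp_all
  then show "matrix_step (pushm (l, r)) (U @ Nt 4 # V) (U @ l @ Nt 4 # bits r @ V)"
    by (simp add: matrix_step_def pushm_def)
qed

text \<open>The bit left of the head is marked X and its equal on the right Y; then X and S are
  erased and Y becomes S. The last step is permitted because \<open>U\<close> contains no X.\<close>

lemma pop_bit:
  assumes "set U \<subseteq> CL"
  shows "(scm_step M)\<^sup>*\<^sup>* (U @ bits [b] @ Nt 4 # bits (b # V)) (U @ Nt 4 # bits V)"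
proof -
  let ?k = "if b then 0 else 1 :: nat"
  have s1: "scm_step M (U @ bits [b] @ Nt 4 # bits (b # V)) (U @ [Nt 2, Nt 4, Nt 3] @ bits V)"
  proof (rule M_stepI)
    show "markm ?k \<in> sM M" by (simp add: M_def)
    have "rewrite_seq [(?k, [Nt 2]), (?k, [Nt 3])] (U @ bits [b] @ Nt 4 # bits (b # V)) (U @ [Nt 2, Nt 4, Nt 3] @ bits V)"
      by (rule rewrite_seq2I[of _ U _ "Nt 4 # bits (b # V)" _ "U @ [Nt 2, Nt 4]" _ "bits V"]) simp_all
    then show "matrix_step (markm ?k) (U @ bits [b] @ Nt 4 # bits (b # V)) (U @ [Nt 2, Nt 4, Nt 3] @ bits V)"
      by (simp add: matrix_step_def markm_def)
  qed
  have s2: "scm_step M (U @ [Nt 2, Nt 4, Nt 3] @ bits V) (U @ Nt 3 # bits V)"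
  proof (rule M_stepI)
    show "popm \<in> sM M" by (simp add: M_def)
    have "rewrite_seq [(2, []), (4, [])] (U @ [Nt 2, Nt 4, Nt 3] @ bits V) (U @ Nt 3 # bits V)"
      by (rule rewrite_seq2I[of _ U _ "Nt 4 # Nt 3 # bits V" _ U _ "Nt 3 # bits V"]) simp_all
    moreover have "sublist [Nt 2, Nt 4, Nt 3] (U @ [Nt 2, Nt 4, Nt 3] @ bits V)"
      by (rule sublist_appendI)
    ultimately show "matrix_step popm (U @ [Nt 2, Nt 4, Nt 3] @ bits V) (U @ Nt 3 # bits V)"
      by (simp add: matrix_step_def popm_def)
  qed
  have s3: "scm_step M (U @ Nt 3 # bits V) (U @ Nt 4 # bits V)"
  proof (rule M_stepI)
    show "backm \<in> sM M" by (simp add: M_def)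
    have "Nt 2 \<notin> set (U @ Nt 3 # bits V)" using CL_bits_notin[OF assms, of 2 V] by simp
    then show "matrix_step backm (U @ Nt 3 # bits V) (U @ Nt 4 # bits V)"
      unfolding matrix_step_def backm_def by (auto simp: sublist_singleton)
  qed
  show ?thesis using s1 s2 s3 by (meson converse_rtranclp_into_rtranclp rtranclp.rtrancl_refl)
qed

lemma pop_bits:
  assumes "set U \<subseteq> CL"
  shows "(scm_step M)\<^sup>*\<^sup>* (U @ bits (rev x) @ Nt 4 # bits (x @ V)) (U @ Nt 4 # bits V)"
proof (induction x)
  case (Cons b x)
  have "set (U @ bits (rev x)) \<subseteq> CL" using assms set_bits[of "rev x"] by auto
  from pop_bit[OF this, of b "x @ V"] Cons show ?case by (auto intro: rtranclp_trans)
qed simp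

lemma False_in_bits: "False \<in> set V \<Longrightarrow> Nt 1 \<in> set (bits V)"
  by (force simp: bits_def)

text \<open>After the push, the mirrored code of \<open>a\<close> faces its code on the right and
  cancels, leaving the rule name on the left. The B required by a push comes from
  \<open>V\<close>.\<close>

lemma consume:
  assumes "set U \<subseteq> CL" "(a, b) \<in> RR" "False \<in> set V"
  shows "(scm_step M)\<^sup>*\<^sup>* (U @ Nt 4 # bits (enc a @ V)) (U @ bits (rev (cd (rc (a, b)))) @ Nt 4 # bits V)"
proof -
  let ?l = "bits (rev (cds (map e a @ [rc (a, b)])))"
  have "(?l, []) \<in> push" using assms(2) by (force simp: push_def)
  then have "scm_step M (U @ Nt 4 # bits (enc a @ V)) (U @ ?l @ Nt 4 # bits [] @ bits (enc a @ V))"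
    by (rule push_step) (use False_in_bits[OF assms(3)] in auto)
  also have "U @ ?l @ Nt 4 # bits [] @ bits (enc a @ V)
      = (U @ bits (rev (cd (rc (a, b))))) @ bits (rev (enc a)) @ Nt 4 # bits (enc a @ V)"
    by (simp add: enc_def)
  also have "(scm_step M)\<^sup>*\<^sup>* \<dots> ((U @ bits (rev (cd (rc (a, b))))) @ Nt 4 # bits V)"
    by (rule pop_bits) (use assms(1) set_bits[of "rev (cd (rc (a, b)))"] in auto)
  finally show ?thesis by simp
qed

text \<open>Pushing \<open>r b\<close> on the right makes the name meet its mirror image; cancelling
  them leaves \<open>b\<close>.\<close>

lemma produce:
  assumes "set U \<subseteq> CL" "(a, b) \<in> RR" "False \<in> set V"
  shows "(scm_step M)\<^sup>*\<^sup>* (U @ bits (rev (cd (rc (a, b)))) @ Nt 4 # bits V) (U @ Nt 4 # bits (enc b @ V))"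
proof -
  let ?d = "cd (rc (a, b))" and ?U = "U @ bits (rev (cd (rc (a, b))))"
  have "([], cds (rc (a, b) # map e b)) \<in> push" using assms(2) by (force simp: push_def)
  then have "scm_step M (?U @ Nt 4 # bits V) (?U @ [] @ Nt 4 # bits (cds (rc (a, b) # map e b)) @ bits V)"
    by (rule push_step) (use False_in_bits[OF assms(3)] in auto)
  also have "?U @ [] @ Nt 4 # bits (cds (rc (a, b) # map e b)) @ bits V
      = U @ bits (rev ?d) @ Nt 4 # bits (?d @ enc b @ V)"
    by (simp add: enc_def)
  also have "(scm_step M)\<^sup>*\<^sup>* \<dots> (U @ Nt 4 # bits (enc b @ V))"
    by (rule pop_bits) (use assms(1) in auto)
  finally show ?thesis by simp
qed

text \<open>The identity rules \<^term>\<open>([s], [s])\<close> let the head travel to the redex: consuming s leaves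
  its rule name on the left, and producing s on the way back removes it again.\<close>

lemma rule_simulated:
  assumes "(a, b) \<in> RR" "set x1 \<subseteq> V\<^sub>G" "set U \<subseteq> CL"
  shows "(scm_step M)\<^sup>*\<^sup>* (U @ Nt 4 # bits (enc (x1 @ a @ x2) @ [False]))
    (U @ Nt 4 # bits (enc (x1 @ b @ x2) @ [False]))"
  using assms(2,3)
proof (induction x1 arbitrary: U)
  case Nil
  have "(scm_step M)\<^sup>*\<^sup>* (U @ Nt 4 # bits (enc a @ enc x2 @ [False]))
    (U @ Nt 4 # bits (enc b @ enc x2 @ [False]))"
    using consume[OF Nil(2) assms(1), of "enc x2 @ [False]"] produce[OF Nil(2) assms(1), of "enc x2 @ [False]"]
    by (auto intro: rtranclp_trans)
  then show ?case by simp
next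
  case (Cons s x1)
  have s: "([s], [s]) \<in> RR" using Cons.prems by (auto simp: RR_def)
  let ?U = "U @ bits (rev (cd (rc ([s], [s]))))"
  have "(scm_step M)\<^sup>*\<^sup>* (U @ Nt 4 # bits (enc [s] @ enc (x1 @ a @ x2) @ [False]))
      (?U @ Nt 4 # bits (enc (x1 @ a @ x2) @ [False]))"
    using consume[OF Cons.prems(2) s, of "enc (x1 @ a @ x2) @ [False]"] by simp
  also have "(scm_step M)\<^sup>*\<^sup>* \<dots> (?U @ Nt 4 # bits (enc (x1 @ b @ x2) @ [False]))"
    by (rule Cons.IH) (use Cons.prems set_bits[of "rev (cd (rc ([s], [s])))"] in auto)
  also have "(scm_step M)\<^sup>*\<^sup>* \<dots> (U @ Nt 4 # bits (enc [s] @ enc (x1 @ b @ x2) @ [False]))"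
    using produce[OF Cons.prems(2) s, of "enc (x1 @ b @ x2) @ [False]"] by simp
  finally show ?case by simp
qed

lemma derivation_simulated:
  assumes "(psg_step G)\<^sup>*\<^sup>* [Nt (gS G)] x"
  shows "set x \<subseteq> V\<^sub>G \<and> (scm_step M)\<^sup>*\<^sup>* (Nt 4 # bits (enc [Nt (gS G)] @ [False])) (Nt 4 # bits (enc x @ [False]))"
  using assms
proof induction
  case base
  show ?case using gS_V by simp
next
  case (step x y)
  from step.hyps(2) obtain a b u v where ab: "(a, b) \<in> gR G" "x = u @ a @ v" "y = u @ b @ v"
    unfolding psg_step_def by blast
  then have "(a, b) \<in> RR" by (simp add: RR_def)
  then show ?case using step.IH ab rule_simulated[of a b u "[]" v] RR_props[of a b]
    by (auto intro: rtranclp_trans)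
qed

text \<open>Each terminal is written to the left of the head, and the code pushed after it cancels
  the corresponding code on the right. The final B remains for \<open>finm\<close>.\<close>

lemma output_word:
  assumes "set w \<subseteq> gT G"
  shows "(scm_step M)\<^sup>*\<^sup>* (map Tm w0 @ Nt 4 # bits (enc (map Tm w) @ [False])) (map Tm (w0 @ w) @ Nt 4 # bits [False])"
  using assms
proof (induction w arbitrary: w0)
  case (Cons t w)
  let ?d = "cd (e (Tm t))" and ?V = "enc (map Tm w) @ [False]"
  have "(Tm t # bits (rev ?d), []) \<in> push" using Cons.prems by (simp add: push_def)
  then have "scm_step M (map Tm w0 @ Nt 4 # bits (?d @ ?V))
      (map Tm w0 @ (Tm t # bits (rev ?d)) @ Nt 4 # bits [] @ bits (?d @ ?V))"
    by (rule push_step) auto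
  also have "map Tm w0 @ (Tm t # bits (rev ?d)) @ Nt 4 # bits [] @ bits (?d @ ?V)
      = map Tm (w0 @ [t]) @ bits (rev ?d) @ Nt 4 # bits (?d @ ?V)" by simp
  also have "(scm_step M)\<^sup>*\<^sup>* \<dots> (map Tm (w0 @ [t]) @ Nt 4 # bits ?V)"
    by (rule pop_bits) auto
  also have "(scm_step M)\<^sup>*\<^sup>* \<dots> (map Tm ((w0 @ [t]) @ w) @ Nt 4 # bits [False])"
    by (rule Cons.IH) (use Cons.prems in simp)
  finally show ?case by simp
qed simp

lemma psg_lang_subset_M: "psg_lang G \<subseteq> scm_lang M"
proof
  fix w assume "w \<in> psg_lang G"
  then have w: "set w \<subseteq> gT G" and d: "(psg_step G)\<^sup>*\<^sup>* [Nt (gS G)] (map Tm w)" by (auto simp: psg_lang_def)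
  have "scm_step M [Nt 4] (Nt 4 # bits (enc [Nt (gS G)] @ [False]))"
    by (rule M_stepI[of startm]) (auto simp: M_def matrix_step_def startm_def)
  also have "(scm_step M)\<^sup>*\<^sup>* \<dots> (map Tm [] @ Nt 4 # bits (enc (map Tm w) @ [False]))"
    using derivation_simulated[OF d] by simp
  also have "(scm_step M)\<^sup>*\<^sup>* \<dots> (map Tm ([] @ w) @ Nt 4 # bits [False])"
    by (rule output_word[OF w])
  also have "scm_step M \<dots> (map Tm w)"
  proof (rule M_stepI[of finm])
    have "rewrite_seq [(1, []), (4, [])] (map Tm w @ [Nt 4, Nt 1]) (map Tm w)"
      by (rule rewrite_seq2I[of _ "map Tm w @ [Nt 4]" _ "[]" _ "map Tm w" _ "[]"]) simp_all
    then show "matrix_step finm (map Tm ([] @ w) @ Nt 4 # bits [False]) (map Tm w)"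
      by (simp add: matrix_step_def finm_def)
  qed (simp add: M_def)
  finally show "w \<in> scm_lang M" using w by (simp add: scm_lang_def M_def)
qed

lemma scm_lang_M: "scm_lang M = psg_lang G"
  using psg_lang_subset_M scm_lang_M_subset by blast

end

theorem RE_in_SSCM:
  assumes "is_RE (L :: 't list set)"
  shows "\<exists>M :: 't scm. in_SSCM 3 1 5 2 2 M \<and> scm_lang M = L"
proof -
  from assms obtain G where G: "psg_wf G" "psg_lang G = L" unfolding is_RE_def by blast
  define RR where "RR = gR G \<union> (\<lambda>s. ([s], [s])) ` psg_V G"
  have fin: "finite (psg_V G)" "finite RR" using G(1) by (auto simp: psg_wf_def psg_V_def RR_def)
  obtain f :: "'t sym \<Rightarrow> nat" where f: "inj_on f (psg_V G)" using finite_imp_inj_to_nat_seg[OF fin(1)] by blast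
  obtain g :: "'t sym list \<times> 't sym list \<Rightarrow> nat" where g: "inj_on g RR" using finite_imp_inj_to_nat_seg[OF fin(2)] by blast
  \<comment> \<open>Even numbers for symbols and odd numbers for rule names keep them apart.\<close>
  interpret psg_coding G RR "\<lambda>s. 2 * f s" "\<lambda>\<rho>. 2 * g \<rho> + 1"
  proof
    show "inj_on (\<lambda>s. 2 * f s) (psg_V G)" using f by (simp add: inj_on_def)
    show "inj_on (\<lambda>\<rho>. 2 * g \<rho> + 1) RR" using g by (simp add: inj_on_def)
    show "2 * f s \<noteq> 2 * g \<rho> + 1" for s \<rho> by presburger
  qed (fact G(1) RR_def)+
  show ?thesis using M_in_SSCM scm_lang_M G(2) by blast
qed

theorem mainTheorem2:
  fixes L :: "'t list set"
  shows "is_RE L \<longleftrightarrow> (\<exists>G :: 't scm. in_SSCM 3 1 5 2 2 G \<and> scm_lang G = L)"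
  using RE_in_SSCM simple_scm_lang_RE by metis

end
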